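(* Let $\nu>0$. Then for every integer $n\ge1$, $$\sum_{k \ge 1} \frac{\big[ (j_k^{\nu})'\big]^2}{\Big[ \big[ (j_k^{\nu})'\big]^2 - \nu^2 \Big] \Big[ \big(j_n^{\nu+1}\big)^2 - \big[ (j_k^{\nu})'\big]^2\Big]^2} = \frac{1}{4\nu^2}.$$
   Context: For $\mu>-1$, $\{j_n^{\mu}: n\ge1\}$ denotes the sequence of strictly positive zeros, in ascending order, of the Bessel function of the first kind $J_\mu$, and $\{(j_n^{\mu})': n\ge1\}$ denotes the sequence of strictly positive zeros, in ascending order, of the derivative $J_\mu'$; the prime in $(j_n^\mu)'$ is only notation. *)

theory Defs
  imports "HOL-Analysis.Analysis"
begin

text \<open>
  Bessel function of the first kind of real order \<open>\<mu> > -1\<close>, by its power series; the definition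
  is only meant for arguments \<open>x > 0\<close>, where \<open>powr\<close> is the usual real power.
\<close>

definition bessel_J :: "real \<Rightarrow> real \<Rightarrow> real" where
  "bessel_J \<mu> x =
     (\<Sum>m. (-1) ^ m / (fact m * Gamma (real m + \<mu> + 1)) * (x / 2) powr (2 * real m + \<mu>))"

text \<open>
  \<open>pos_zero f n\<close>, for \<open>n \<ge> 1\<close>, is the \<open>n\<close>-th strictly positive zero of \<open>f\<close> in ascending order
  (zeros counted without multiplicity).  The value at index \<open>0\<close> is only the starting
  point of the recursion and is not a zero in the sequence.  \<open>LEAST\<close> is meaningful at every
  stage because each function used below has infinitely many positive zeros, without
  accumulation point in \<open>[0, \<infinity>)\<close>.
\<close>

primrec pos_zero :: "(real \<Rightarrow> real) \<Rightarrow> nat \<Rightarrow> real" where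
  "pos_zero f 0 = 0"
| "pos_zero f (Suc n) = (LEAST x. pos_zero f n < x \<and> f x = 0)"

definition bessel_zero :: "real \<Rightarrow> nat \<Rightarrow> real" where
  "bessel_zero \<mu> = pos_zero (bessel_J \<mu>)"

definition bessel_deriv_zero :: "real \<Rightarrow> nat \<Rightarrow> real" where
  "bessel_deriv_zero \<mu> = pos_zero (deriv (bessel_J \<mu>))"

end

theory Submission
  imports Defs "HOL-Complex_Analysis.Complex_Analysis" "HOL-Real_Asymp.Real_Asymp"
begin

text \<open>
  Write \<open>J\<^sub>\<nu>(x) = (x/2)\<^sup>\<nu> h(x\<^sup>2)\<close> and \<open>J\<^sub>\<nu>'(x) = (x/2)\<^sup>\<nu> P(x\<^sup>2) / x\<close> with entire \<open>h\<close> and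
  \<open>P\<close>, and let \<open>M = h / P\<close>.  The squares of the zeros of \<open>J\<^sub>\<nu>'\<close> are the poles \<open>A\<close> of \<open>M\<close>, with
  residue \<open>-c\<^sub>A\<close> where \<open>c\<^sub>A = 2 A / (A - \<nu>\<^sup>2)\<close>.  The sum of the theorem is half of
  \<open>\<Sum>\<^sub>A c\<^sub>A / (A - x)\<^sup>2\<close> at \<open>x = b\<^sup>2\<close>, the square of a zero of \<open>J\<^sub>\<nu>\<^sub>+\<^sub>1\<close>.  Hence it suffices to prove the
  differentiated partial fraction expansion \<open>M'(x) = \<Sum>\<^sub>A c\<^sub>A / (A - x)\<^sup>2\<close>: the zeros of
  \<open>J\<^sub>\<nu>\<^sub>+\<^sub>1\<close> are those of \<open>h'\<close>, there \<open>P = \<nu> h\<close>, and so \<open>M' = 1 / (2 \<nu>\<^sup>2)\<close>.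

  The expansion is obtained without contour estimates for Bessel functions, because \<open>M\<close> is a
  Nevanlinna function: its imaginary part has the sign of \<open>Im w\<close>.  More precisely, the functions
  \<open>s \<mapsto> h(A s)\<close> are orthogonal on \<open>[0,1]\<close> for the weight \<open>s\<^sup>\<nu>\<close>, and Bessel's inequality for the
  expansion of \<open>s \<mapsto> h(w s)\<close> says that \<open>M\<close> minus any finite number of its principal parts still
  is a Nevanlinna function (\<open>bessel_inequality\<close>).  If all poles in the disc of radius \<open>R\<close> have been
  removed, this remainder is holomorphic in the disc, and positivity of its imaginary part
  bounds its \<open>n\<close>-th Taylor coefficient at \<open>0\<close> by \<open>n R\<^sup>1\<^sup>-\<^sup>n\<close> times the first one
  (\<open>nevanlinna_coeff_bound\<close>).  As \<open>R\<close> grows, the derivative of the remainder therefore becomes a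
  constant \<open>\<beta> \<ge> 0\<close>.  On the negative axis \<open>M'\<close> is at least \<open>\<beta>\<close> while \<open>0 \<le> M \<le> 1/\<nu>\<close>,
  so \<open>\<beta> = 0\<close> (\<open>partial_fractions_limit\<close>).

  The enumerations of zeros are meaningful only if there are infinitely many of them.  Finitely
  many poles would make \<open>M\<close> a rational function, which contradicts the Riccati equation of \<open>M\<close>
  (\<open>infinite_ent_dJ_zeros\<close>); Rolle's theorem carries the result over to \<open>J\<^sub>\<nu>\<close> and \<open>J\<^sub>\<nu>\<^sub>+\<^sub>1\<close>.
\<close>

section \<open>The entire part of the Bessel function\<close>

text \<open>
  Coefficients of the entire function \<open>h\<close> with \<open>J\<^sub>\<nu>(x) = (x/2)\<^sup>\<nu> h(x\<^sup>2)\<close>.  The argument is squared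
  so that all zeros of interest become positive reals.
\<close>
definition bessel_coeff :: "real \<Rightarrow> nat \<Rightarrow> real" where
  "bessel_coeff \<nu> m = (-1/4) ^ m / (fact m * Gamma (real m + \<nu> + 1))"

text \<open>
  The function \<open>h\<close>.  It is polymorphic so that the real and the complex version share one theory.
\<close>
definition ent_J :: "real \<Rightarrow> 'a \<Rightarrow> 'a::{real_normed_field,banach}" where
  "ent_J \<nu> w = (\<Sum>m. of_real (bessel_coeff \<nu> m) * w ^ m)"

lemma Gamma_shift2:
  assumes "\<nu> > 0"
  shows "Gamma (real m + \<nu> + 2) = (real m + \<nu> + 1) * Gamma (real m + \<nu> + 1)"
proof -
  have "real m + \<nu> + 1 \<notin> \<int>\<^sub>\<le>\<^sub>0"
    using assms by (auto elim!: nonpos_Ints_cases)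
  from Gamma_plus1[OF this] show ?thesis by (simp add: add_ac)
qed

lemma Gamma_pos: "\<nu> > 0 \<Longrightarrow> Gamma (real m + \<nu> + 1) > 0"
  by (intro Gamma_real_pos) auto

lemma bessel_coeff_Suc:
  assumes "\<nu> > 0"
  shows "bessel_coeff \<nu> (Suc m) = - bessel_coeff \<nu> m / (4 * (real m + 1) * (real m + \<nu> + 1))"
proof -
  have "real (Suc m) + \<nu> + 1 = real m + \<nu> + 2" by simp
  moreover have "real m + \<nu> + 1 > 0" using assms by simp
  ultimately show ?thesis
    using Gamma_pos[OF assms, of m] unfolding bessel_coeff_def
    by (simp only: Gamma_shift2[OF assms] power_Suc fact_Suc) (simp add: divide_simps)
qed

lemma bessel_coeff_shift:
  assumes "\<nu> > 0"
  shows "bessel_coeff \<nu> m = (real m + \<nu> + 1) * bessel_coeff (\<nu> + 1) m"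
proof -
  have "real m + (\<nu> + 1) + 1 = real m + \<nu> + 2" by simp
  moreover have "real m + \<nu> + 1 > 0" using assms by simp
  ultimately show ?thesis
    using Gamma_pos[OF assms, of m] unfolding bessel_coeff_def
    by (simp only: Gamma_shift2[OF assms]) (simp add: divide_simps)
qed

lemma summable_ent_J:
  fixes w :: "'a::{real_normed_field,banach}"
  assumes "\<nu> > 0"
  shows "summable (\<lambda>m. of_real (bessel_coeff \<nu> m) * w ^ m)"
proof (rule summable_ratio_test[where c = "1/2" and N = "nat \<lceil>norm w\<rceil>"])
  fix m assume m: "m \<ge> nat \<lceil>norm w\<rceil>"
  hence "norm w \<le> real m" by linarith
  moreover have "real m \<le> (real m + 1) * (real m + \<nu> + 1)"
    using assms by (simp add: algebra_simps)
  ultimately have "norm w / (4 * (real m + 1) * (real m + \<nu> + 1)) \<le> 1/2"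
  proof -
    have "0 < (real m + 1) * (real m + \<nu> + 1)" using assms by simp
    thus ?thesis using \<open>norm w \<le> real m\<close> \<open>real m \<le> _\<close> norm_ge_zero[of w]
      unfolding mult.assoc by (subst pos_divide_le_eq; linarith)
  qed
  hence "norm w / (4 * (real m + 1) * (real m + \<nu> + 1)) * norm (of_real (bessel_coeff \<nu> m) * w ^ m)
     \<le> 1/2 * norm (of_real (bessel_coeff \<nu> m) * w ^ m)"
    by (rule mult_right_mono) auto
  also have "norm w / (4 * (real m + 1) * (real m + \<nu> + 1)) * norm (of_real (bessel_coeff \<nu> m) * w ^ m)
     = norm (of_real (bessel_coeff \<nu> (Suc m)) * w ^ Suc m)"
    using assms unfolding bessel_coeff_Suc[OF assms] norm_mult norm_power norm_of_real power_Suc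
    by (simp add: abs_mult)
  finally show "norm (of_real (bessel_coeff \<nu> (Suc m)) * w ^ Suc m)
     \<le> 1/2 * norm (of_real (bessel_coeff \<nu> m) * w ^ m)" .
qed auto

lemma ent_J_sums:
  "\<nu> > 0 \<Longrightarrow> (\<lambda>m. of_real (bessel_coeff \<nu> m) * w ^ m) sums ent_J \<nu> w"
  unfolding ent_J_def by (rule summable_sums) (rule summable_ent_J)

lemma ent_J_of_real:
  assumes "\<nu> > 0"
  shows "ent_J \<nu> (of_real x) = (of_real (ent_J \<nu> x) :: 'a::{real_normed_field,banach})"
proof -
  have "(\<lambda>m. of_real (of_real (bessel_coeff \<nu> m) * x ^ m) :: 'a) sums of_real (ent_J \<nu> x)"
    by (rule sums_of_real) (rule ent_J_sums[OF assms])
  thus ?thesis using ent_J_sums[OF assms, of "of_real x :: 'a"]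
    by (simp add: sums_iff)
qed

lemma ent_J_cnj:
  assumes "\<nu> > 0"
  shows "ent_J \<nu> (cnj w) = cnj (ent_J \<nu> w)"
proof -
  have "(\<lambda>m. cnj (of_real (bessel_coeff \<nu> m) * w ^ m)) sums cnj (ent_J \<nu> w)"
    using ent_J_sums[OF assms, of w] by (simp only: sums_cnj)
  thus ?thesis using ent_J_sums[OF assms, of "cnj w"]
    by (simp add: sums_iff)
qed

lemma ent_J_deriv:
  fixes w :: "'a::{real_normed_field,banach}"
  assumes "\<nu> > 0"
  shows "(ent_J \<nu> has_field_derivative (- ent_J (\<nu> + 1) w / 4)) (at w)"
proof -
  have "((\<lambda>w. \<Sum>m. of_real (bessel_coeff \<nu> m) * w ^ m) has_field_derivative
      (\<Sum>m. diffs (\<lambda>m. of_real (bessel_coeff \<nu> m)) m * w ^ m)) (at w)"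
    by (rule termdiffs_strong_converges_everywhere) (rule summable_ent_J[OF assms])
  moreover have "diffs (\<lambda>m. of_real (bessel_coeff \<nu> m)) m = (- of_real (bessel_coeff (\<nu> + 1) m) / 4 :: 'a)" for m
  proof -
    have "real (Suc m) * bessel_coeff \<nu> (Suc m) = - bessel_coeff (\<nu> + 1) m / 4"
    proof -
      have "real m + \<nu> + 1 > 0" using assms by simp
      thus ?thesis unfolding bessel_coeff_Suc[OF assms] bessel_coeff_shift[OF assms, of m]
        by (simp add: divide_simps)
    qed
    hence "(of_real (real (Suc m) * bessel_coeff \<nu> (Suc m)) :: 'a) = of_real (- bessel_coeff (\<nu> + 1) m / 4)"
      by (rule arg_cong)
    thus ?thesis by (simp add: diffs_def)
  qed
  moreover have "(\<Sum>m. (- of_real (bessel_coeff (\<nu> + 1) m) / 4) * w ^ m) = - ent_J (\<nu> + 1) w / 4"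
  proof -
    have "(\<lambda>m. (-1/4) * (of_real (bessel_coeff (\<nu> + 1) m) * w ^ m)) sums ((-1/4) * ent_J (\<nu> + 1) w)"
      by (rule sums_mult, rule ent_J_sums) (use assms in auto)
    thus ?thesis by (simp add: sums_iff)
  qed
  ultimately show ?thesis by (simp add: ent_J_def[abs_def])
qed

text \<open>
  The three-term recurrence of the Bessel functions.  Together with \<open>h' = - ent_J (\<nu> + 1) / 4\<close> it is
  Bessel's equation \<open>w h'' + (\<nu> + 1) h' + h / 4 = 0\<close>.
\<close>
lemma ent_J_recurrence:
  fixes w :: "'a::{real_normed_field,banach}"
  assumes "\<nu> > 0"
  shows "w * ent_J (\<nu> + 2) w = 4 * (of_real (\<nu> + 1) * ent_J (\<nu> + 1) w - ent_J \<nu> w)"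
proof -
  have a: "(\<lambda>m. 4 * (of_real (\<nu> + 1) * (of_real (bessel_coeff (\<nu> + 1) m) * w ^ m) -
      of_real (bessel_coeff \<nu> m) * w ^ m)) sums (4 * (of_real (\<nu> + 1) * ent_J (\<nu> + 1) w - ent_J \<nu> w))"
    (is "?g sums _")
    by (intro sums_mult sums_diff ent_J_sums) (use assms in auto)
  have "(\<lambda>m. w * (of_real (bessel_coeff (\<nu> + 2) m) * w ^ m)) sums (w * ent_J (\<nu> + 2) w)"
    by (intro sums_mult ent_J_sums) (use assms in auto)
  also have "(\<lambda>m. w * (of_real (bessel_coeff (\<nu> + 2) m) * w ^ m)) = (\<lambda>m. ?g (Suc m))"
  proof
    fix m
    have "bessel_coeff (\<nu> + 2) m = 4 * ((\<nu> + 1) * bessel_coeff (\<nu> + 1) (Suc m) - bessel_coeff \<nu> (Suc m))"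
    proof -
      have 1: "bessel_coeff \<nu> (Suc m) = (real m + \<nu> + 2) * bessel_coeff (\<nu> + 1) (Suc m)"
        using bessel_coeff_shift[OF assms, of "Suc m"] by (simp add: algebra_simps)
      have "bessel_coeff (\<nu> + 1) m = (real m + \<nu> + 2) * bessel_coeff (\<nu> + 2) m"
        using bessel_coeff_shift[of "\<nu> + 1" m] assms by (simp add: algebra_simps)
      moreover have "bessel_coeff (\<nu> + 1) (Suc m) = - bessel_coeff (\<nu> + 1) m / (4 * (real m + 1) * (real m + \<nu> + 2))"
        using bessel_coeff_Suc[of "\<nu> + 1" m] assms by (simp add: algebra_simps)
      moreover have "real m + \<nu> + 2 > 0" using assms by simp
      ultimately have "bessel_coeff (\<nu> + 1) (Suc m) * (4 * (real m + 1)) = - bessel_coeff (\<nu> + 2) m"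
        by (simp add: divide_simps)
      hence "bessel_coeff (\<nu> + 2) m = - (4 * (real m + 1) * bessel_coeff (\<nu> + 1) (Suc m))"
        by (simp add: mult.commute)
      thus ?thesis using 1 by algebra
    qed
    hence "(of_real (bessel_coeff (\<nu> + 2) m) :: 'a)
        = of_real (4 * ((\<nu> + 1) * bessel_coeff (\<nu> + 1) (Suc m) - bessel_coeff \<nu> (Suc m)))"
      by (rule arg_cong)
    also have "\<dots> = 4 * (of_real (\<nu> + 1) * of_real (bessel_coeff (\<nu> + 1) (Suc m)) - of_real (bessel_coeff \<nu> (Suc m)))"
      by (simp only: of_real_mult of_real_diff of_real_numeral)
    finally show "w * (of_real (bessel_coeff (\<nu> + 2) m) * w ^ m) = ?g (Suc m)"
      by (simp only: power_Suc) (simp only: ring_distribs mult_ac right_diff_distrib)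
  qed
  finally have "?g sums (w * ent_J (\<nu> + 2) w + ?g 0)"
    by (rule sums_Suc)
  moreover have "?g 0 = 0"
    using bessel_coeff_shift[OF assms, of 0] by simp
  ultimately show ?thesis using a sums_unique2 by fastforce
qed

lemma ent_J_pos:
  assumes "\<nu> > 0" "x \<le> 0"
  shows "ent_J \<nu> (x::real) > 0"
proof -
  have nn: "bessel_coeff \<nu> m * x ^ m \<ge> 0" for m
  proof -
    have "bessel_coeff \<nu> m * x ^ m = (-x/4) ^ m / (fact m * Gamma (real m + \<nu> + 1))"
    proof -
      have "(-x/4) ^ m = (-1/4 * x) ^ m" by simp
      thus ?thesis unfolding bessel_coeff_def by (simp only: power_mult_distrib) simp
    qed
    thus ?thesis using assms Gamma_pos[OF assms(1), of m] by simp
  qed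
  have "0 < bessel_coeff \<nu> 0 * x ^ 0"
    using Gamma_pos[OF assms(1), of 0] by (simp add: bessel_coeff_def)
  also have "\<dots> = (\<Sum>m\<in>{0}. bessel_coeff \<nu> m * x ^ m)" by simp
  also have "\<dots> \<le> (\<Sum>m. bessel_coeff \<nu> m * x ^ m)"
    by (rule sum_le_suminf) (use summable_ent_J[OF assms(1), of x] nn in auto)
  finally show ?thesis by (simp add: ent_J_def)
qed

lemma ent_J_chain [derivative_intros]:
  fixes f :: "'a \<Rightarrow> 'a::{real_normed_field,banach}"
  assumes "\<nu> > 0" "(f has_field_derivative f') (at x within A)"
  shows "((\<lambda>x. ent_J \<nu> (f x)) has_field_derivative (- ent_J (\<nu> + 1) (f x) / 4 * f')) (at x within A)"
  using DERIV_chain2[OF ent_J_deriv[OF assms(1)] assms(2)] .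

lemma continuous_on_ent_J [continuous_intros]:
  fixes f :: "'b::t2_space \<Rightarrow> 'a::{real_normed_field,banach}"
  assumes "\<nu> > 0" "continuous_on A f"
  shows "continuous_on A (\<lambda>x. ent_J \<nu> (f x))"
proof -
  have "continuous_on UNIV (ent_J \<nu> :: 'a \<Rightarrow> 'a)"
    using ent_J_deriv[OF assms(1)] by (blast intro: continuous_at_imp_continuous_on DERIV_isCont)
  thus ?thesis using continuous_on_compose2 assms(2) by blast
qed

text \<open>
  \<open>P(w) = \<nu> h(w) + 2 w h'(w)\<close>, the entire part of \<open>x J\<^sub>\<nu>'(x)\<close>.
\<close>
definition ent_dJ :: "real \<Rightarrow> 'a \<Rightarrow> 'a::{real_normed_field,banach}" where
  "ent_dJ \<nu> w = of_real \<nu> * ent_J \<nu> w - w * ent_J (\<nu> + 1) w / 2"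

text \<open>
  The Wronskian-type expression \<open>h' P - h P'\<close>, that is the numerator of the derivative of \<open>h / P\<close>,
  with all derivatives eliminated.
\<close>
definition ent_W :: "real \<Rightarrow> 'a \<Rightarrow> 'a::{real_normed_field,banach}" where
  "ent_W \<nu> w = w * (ent_J (\<nu> + 1) w)\<^sup>2 / 8 + (ent_J \<nu> w)\<^sup>2 / 2 - of_real \<nu> * ent_J \<nu> w * ent_J (\<nu> + 1) w / 2"

lemma ent_dJ_deriv:
  fixes w :: "'a::{real_normed_field,banach}"
  assumes "\<nu> > 0"
  shows "(ent_dJ \<nu> has_field_derivative (of_real \<nu> * ent_J (\<nu> + 1) w / 4 - ent_J \<nu> w / 2)) (at w)"
proof -
  have "(ent_dJ \<nu> has_field_derivative (- of_real \<nu> * ent_J (\<nu> + 1) w / 4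
      - (ent_J (\<nu> + 1) w - w * ent_J (\<nu> + 2) w / 4) / 2)) (at w)"
    unfolding ent_dJ_def[abs_def] using assms
    by (auto intro!: derivative_eq_intros simp: field_simps)
  also have "w * ent_J (\<nu> + 2) w = 4 * (of_real (\<nu> + 1) * ent_J (\<nu> + 1) w - ent_J \<nu> w)"
    by (rule ent_J_recurrence[OF assms])
  also have "(- of_real \<nu> * ent_J (\<nu> + 1) w / 4
      - (ent_J (\<nu> + 1) w - 4 * (of_real (\<nu> + 1) * ent_J (\<nu> + 1) w - ent_J \<nu> w) / 4) / 2)
     = of_real \<nu> * ent_J (\<nu> + 1) w / 4 - ent_J \<nu> w / 2"
    by (simp add: field_simps)
  finally show ?thesis .
qed

lemma ent_ratio_deriv:
  fixes w :: "'a::{real_normed_field,banach}"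
  assumes "\<nu> > 0" "ent_dJ \<nu> w \<noteq> 0"
  shows "((\<lambda>w. ent_J \<nu> w / ent_dJ \<nu> w) has_field_derivative ent_W \<nu> w / (ent_dJ \<nu> w)\<^sup>2) (at w)"
proof -
  have "((\<lambda>w. ent_J \<nu> w / ent_dJ \<nu> w) has_field_derivative
     ((- ent_J (\<nu> + 1) w / 4) * ent_dJ \<nu> w - ent_J \<nu> w * (of_real \<nu> * ent_J (\<nu> + 1) w / 4 - ent_J \<nu> w / 2)) /
       (ent_dJ \<nu> w * ent_dJ \<nu> w)) (at w)"
    by (rule DERIV_divide ent_J_deriv ent_dJ_deriv assms)+
  also have "(- ent_J (\<nu> + 1) w / 4) * ent_dJ \<nu> w - ent_J \<nu> w * (of_real \<nu> * ent_J (\<nu> + 1) w / 4 - ent_J \<nu> w / 2)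
     = ent_W \<nu> w"
    by (simp add: ent_W_def ent_dJ_def field_simps power2_eq_square)
  finally show ?thesis by (simp add: power2_eq_square)
qed

text \<open>
  Divided by \<open>P\<^sup>2\<close> this is the Riccati equation \<open>2 w M' = 1 + (w - \<nu>\<^sup>2) M\<^sup>2\<close> of \<open>M = h / P\<close>.
\<close>
lemma ent_W_riccati:
  fixes w :: "'a::{real_normed_field,banach}"
  shows "2 * w * ent_W \<nu> w = (ent_dJ \<nu> w)\<^sup>2 + (w - of_real (\<nu>\<^sup>2)) * (ent_J \<nu> w)\<^sup>2"
  by (simp add: ent_W_def ent_dJ_def field_simps power2_eq_square)

lemma ent_dJ_of_real:
  "\<nu> > 0 \<Longrightarrow> ent_dJ \<nu> (of_real x) = (of_real (ent_dJ \<nu> x) :: 'a::{real_normed_field,banach})"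
  by (simp add: ent_dJ_def ent_J_of_real)

lemma ent_W_of_real:
  "\<nu> > 0 \<Longrightarrow> ent_W \<nu> (of_real x) = (of_real (ent_W \<nu> x) :: 'a::{real_normed_field,banach})"
  by (simp add: ent_W_def ent_J_of_real)

lemma ent_dJ_cnj: "\<nu> > 0 \<Longrightarrow> ent_dJ \<nu> (cnj w) = cnj (ent_dJ \<nu> w)"
  by (simp add: ent_dJ_def ent_J_cnj)

text \<open>
  For non-positive arguments all terms of the series of \<open>h\<close> are non-negative (these are the modified Bessel
  functions), which bounds \<open>h / P\<close> there.
\<close>
lemma ent_dJ_nonpos_arg:
  assumes "\<nu> > 0" "x \<le> 0"
  shows "ent_dJ \<nu> (x::real) > 0" "ent_J \<nu> x / ent_dJ \<nu> x \<le> 1 / \<nu>"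
proof -
  have *: "\<nu> * ent_J \<nu> x \<le> ent_dJ \<nu> x"
    using ent_J_pos[of "\<nu> + 1" x] assms by (simp add: ent_dJ_def mult_nonpos_nonneg)
  moreover have "\<nu> * ent_J \<nu> x > 0" using ent_J_pos[OF assms] assms by simp
  ultimately show "ent_dJ \<nu> x > 0" by linarith
  with * show "ent_J \<nu> x / ent_dJ \<nu> x \<le> 1 / \<nu>"
    using assms by (simp add: field_simps)
qed

section \<open>Orthogonality relations\<close>

lemma continuous_on_powr_01: "p > 0 \<Longrightarrow> continuous_on {0..1} (\<lambda>s::real. s powr p)"
  by (intro continuous_on_powr') (auto intro!: continuous_intros)

text \<open>
  As a function of \<open>s\<close>, \<open>y = h(w s)\<close> solves \<open>(s\<^sup>\<nu>\<^sup>+\<^sup>1 y')' + (w/4) s\<^sup>\<nu> y = 0\<close>.  Lagrange's identity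
  for the spectral parameters \<open>w\<close> and \<open>u\<close> gives the antiderivative \<open>F\<close>.
\<close>
lemma sturm_liouville_bracket:
  fixes w u :: complex
  assumes "\<nu> > 0" and that: "w \<noteq> u"
  shows "((\<lambda>s. of_real (s powr \<nu>) * ent_J \<nu> (w * of_real s) * ent_J \<nu> (u * of_real s)) has_integral
           (w * ent_J (\<nu> + 1) w * ent_J \<nu> u - u * ent_J \<nu> w * ent_J (\<nu> + 1) u) / (w - u)) {0..1}"
proof -
  define F where "F = (\<lambda>s::real. of_real (s powr (\<nu> + 1)) *
     (w * ent_J (\<nu> + 1) (w * of_real s) * ent_J \<nu> (u * of_real s) -
      u * ent_J \<nu> (w * of_real s) * ent_J (\<nu> + 1) (u * of_real s)) / (w - u) :: complex)"
  have "((\<lambda>s. of_real (s powr \<nu>) * ent_J \<nu> (w * of_real s) * ent_J \<nu> (u * of_real s)) has_integral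
      F 1 - F 0) {0..1}"
  proof (rule fundamental_theorem_of_calculus_interior)
    show "continuous_on {0..1} F" unfolding F_def
      using assms that by (intro continuous_intros continuous_on_powr_01) auto
    fix s :: real assume s: "s \<in> {0<..<1}"
    define G where "G = (\<lambda>t. (w * ent_J (\<nu> + 1) (w * t) * ent_J \<nu> (u * t) -
      u * ent_J \<nu> (w * t) * ent_J (\<nu> + 1) (u * t)) / (w - u))"
    define G' where "G' = (w * (- ent_J (\<nu> + 2) (w * of_real s) / 4 * w) * ent_J \<nu> (u * of_real s)
      - u * ent_J \<nu> (w * of_real s) * (- ent_J (\<nu> + 2) (u * of_real s) / 4 * u)) / (w - u)"
    have "\<nu> + 1 > 0" using assms by simp
    note dh = ent_J_chain[OF assms(1)] ent_J_chain[OF \<open>\<nu> + 1 > 0\<close>]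
    have "(G has_field_derivative G') (at (of_real s))"
      unfolding G_def G'_def
      by (rule DERIV_cdivide) (rule derivative_eq_intros dh refl | simp add: algebra_simps)+
    hence dG: "((\<lambda>s. G (of_real s)) has_vector_derivative G') (at s)"
      by (rule has_vector_derivative_real_field)
    have dp: "((\<lambda>s. of_real (s powr (\<nu> + 1)) :: complex) has_vector_derivative
        of_real ((\<nu> + 1) * s powr \<nu>)) (at s)"
      using s by (intro has_vector_derivative_of_real)
        (auto intro!: derivative_eq_intros simp flip: has_real_derivative_iff_has_vector_derivative)
    have rw: "w * of_real s * ent_J (\<nu> + 2) (w * of_real s)
        = 4 * (of_real (\<nu> + 1) * ent_J (\<nu> + 1) (w * of_real s) - ent_J \<nu> (w * of_real s))"
      and ru: "u * of_real s * ent_J (\<nu> + 2) (u * of_real s)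
        = 4 * (of_real (\<nu> + 1) * ent_J (\<nu> + 1) (u * of_real s) - ent_J \<nu> (u * of_real s))"
      by (rule ent_J_recurrence[OF assms(1)])+
    have "of_real s * G' + of_real (\<nu> + 1) * G (of_real s) =
        ent_J \<nu> (w * of_real s) * ent_J \<nu> (u * of_real s)"
    proof -
      have "(w - u) * (of_real s * G') =
        - w / 4 * (w * of_real s * ent_J (\<nu> + 2) (w * of_real s)) * ent_J \<nu> (u * of_real s)
        + u / 4 * ent_J \<nu> (w * of_real s) * (u * of_real s * ent_J (\<nu> + 2) (u * of_real s))"
      proof -
        have "(w - u) * G' = w * (- ent_J (\<nu> + 2) (w * of_real s) / 4 * w) * ent_J \<nu> (u * of_real s)
          - u * ent_J \<nu> (w * of_real s) * (- ent_J (\<nu> + 2) (u * of_real s) / 4 * u)"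
          using that by (simp add: G'_def)
        thus ?thesis by algebra
      qed
      also have "\<dots> = (w - u) * (ent_J \<nu> (w * of_real s) * ent_J \<nu> (u * of_real s)
          - of_real (\<nu> + 1) * G (of_real s))"
      proof -
        have "(w - u) * G (of_real s) = w * ent_J (\<nu> + 1) (w * of_real s) * ent_J \<nu> (u * of_real s) -
          u * ent_J \<nu> (w * of_real s) * ent_J (\<nu> + 1) (u * of_real s)"
          using that by (simp add: G_def)
        thus ?thesis unfolding rw ru by algebra
      qed
      finally have "of_real s * G' = ent_J \<nu> (w * of_real s) * ent_J \<nu> (u * of_real s)
          - of_real (\<nu> + 1) * G (of_real s)"
        using that by simp
      thus ?thesis by simp
    qed
    moreover have pw: "of_real (s powr (\<nu> + 1)) = of_real (s powr \<nu>) * (of_real s :: complex)"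
      using s by (simp add: powr_add)
    ultimately have eq: "of_real (s powr (\<nu> + 1)) * G' + of_real ((\<nu> + 1) * s powr \<nu>) * G (of_real s)
        = of_real (s powr \<nu>) * ent_J \<nu> (w * of_real s) * ent_J \<nu> (u * of_real s)"
      by (simp only: of_real_mult) algebra
    have "F = (\<lambda>s. of_real (s powr (\<nu> + 1)) * G (of_real s))"
      by (simp add: F_def G_def fun_eq_iff)
    thus "(F has_vector_derivative
        of_real (s powr \<nu>) * ent_J \<nu> (w * of_real s) * ent_J \<nu> (u * of_real s)) (at s)"
      using has_vector_derivative_mult[OF dp dG] unfolding eq by simp
  qed auto
  thus ?thesis by (simp add: F_def)
qed

text \<open>
  The limit \<open>u \<rightarrow> w\<close> of the previous identity, for real \<open>w\<close>.  The antiderivative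
  \<open>2 s\<^sup>\<nu>\<^sup>+\<^sup>1 ent_W \<nu> (x s)\<close> rests on \<open>2 ((\<nu> + 1) W + y W') = h\<^sup>2\<close>, where \<open>W\<close> and \<open>h\<close> are taken at \<open>y\<close>.
\<close>
lemma weighted_norm_integral:
  assumes "\<nu> > 0"
  shows "((\<lambda>s. s powr \<nu> * (ent_J \<nu> (x * s))\<^sup>2) has_integral 2 * ent_W \<nu> x) {0..1::real}"
proof -
  define F where "F = (\<lambda>s::real. s powr (\<nu> + 1) * (2 * ent_W \<nu> (x * s)))"
  have "((\<lambda>s. s powr \<nu> * (ent_J \<nu> (x * s))\<^sup>2) has_integral F 1 - F 0) {0..1}"
  proof (rule fundamental_theorem_of_calculus_interior)
    show "continuous_on {0..1} F" unfolding F_def ent_W_def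
      using assms by (intro continuous_intros continuous_on_powr_01) auto
    fix s :: real assume s: "s \<in> {0<..<1}"
    define y a b c where "y = x * s" and "a = ent_J \<nu> y" and "b = ent_J (\<nu> + 1) y" and "c = ent_J (\<nu> + 2) y"
    define E' where "E' = b\<^sup>2 / 4 - y * b * c / 8 - a * b / 2 + \<nu> * b\<^sup>2 / 4 + \<nu> * a * c / 4"
    have "\<nu> + 1 > 0" using assms by simp
    note dh = ent_J_chain[OF assms] ent_J_chain[OF \<open>\<nu> + 1 > 0\<close>]
    have yc: "y * c = 4 * ((\<nu> + 1) * b - a)"
      using ent_J_recurrence[OF assms, of y] by (simp add: a_def b_def c_def)
    have "((\<lambda>y. 2 * ent_W \<nu> y) has_field_derivative E') (at y)"
      unfolding ent_W_def power2_eq_square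
      by (insert assms, (rule derivative_eq_intros dh refl | simp add: E'_def a_def b_def c_def power2_eq_square algebra_simps add_divide_distrib diff_divide_distrib)+)
    hence "((\<lambda>s. 2 * ent_W \<nu> (x * s)) has_field_derivative E' * x) (at s)"
      unfolding y_def by (rule DERIV_chain2) (auto intro!: derivative_eq_intros)
    hence "(F has_field_derivative (\<nu> + 1) * s powr \<nu> * (2 * ent_W \<nu> y) + (E' * x) * s powr (\<nu> + 1)) (at s)"
      unfolding F_def y_def using s
      by (intro DERIV_mult) (auto intro!: derivative_eq_intros)
    moreover have "(\<nu> + 1) * s powr \<nu> * (2 * ent_W \<nu> y) + (E' * x) * s powr (\<nu> + 1) = s powr \<nu> * a\<^sup>2"
    proof -
      have yE: "y * E' = y * b\<^sup>2 * (1 + \<nu>) / 4 - b * y * (y * c) / 8 - y * a * b / 2 + \<nu> * a * (y * c) / 4"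
        by (simp add: E'_def algebra_simps power2_eq_square)
      have ent_W: "ent_W \<nu> y = y * b\<^sup>2 / 8 + a\<^sup>2 / 2 - \<nu> * a * b / 2"
        by (simp add: ent_W_def a_def b_def)
      have "(\<nu> + 1) * (2 * ent_W \<nu> y) + y * E' = a\<^sup>2"
        unfolding yE ent_W yc
        by (simp add: power2_eq_square algebra_simps add_divide_distrib diff_divide_distrib)
      moreover have "s powr (\<nu> + 1) = s powr \<nu> * s" using s by (simp add: powr_add)
      moreover have "y = x * s" by (simp add: y_def)
      ultimately show ?thesis by algebra
    qed
    ultimately show "(F has_vector_derivative s powr \<nu> * (ent_J \<nu> (x * s))\<^sup>2) (at s)"
      by (simp add: has_real_derivative_iff_has_vector_derivative a_def y_def)
  qed auto
  thus ?thesis by (simp add: F_def)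
qed

text \<open>
  In this form the boundary condition is visible: for two different zeros of \<open>P\<close> the right-hand
  side vanishes, which is the orthogonality of the corresponding functions.
\<close>
lemma ent_J_kernel:
  fixes w u :: complex
  assumes "\<nu> > 0" "w \<noteq> u"
  shows "((\<lambda>s. of_real (s powr \<nu>) * ent_J \<nu> (w * of_real s) * ent_J \<nu> (u * of_real s)) has_integral
           2 * (ent_J \<nu> w * ent_dJ \<nu> u - ent_dJ \<nu> w * ent_J \<nu> u) / (w - u)) {0..1}"
proof -
  have "2 * (ent_J \<nu> w * ent_dJ \<nu> u - ent_dJ \<nu> w * ent_J \<nu> u) =
      w * ent_J (\<nu> + 1) w * ent_J \<nu> u - u * ent_J \<nu> w * ent_J (\<nu> + 1) u"
    by (simp add: ent_dJ_def algebra_simps)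
  thus ?thesis using sturm_liouville_bracket[OF assms] by simp
qed

lemma ent_J_0_nonzero:
  assumes "\<nu> > 0" shows "ent_J \<nu> (0 :: complex) \<noteq> 0"
  using ent_J_pos[OF assms, of 0] ent_J_of_real[OF assms, of 0, where 'a = complex] by simp

text \<open>
  A vanishing integral would force \<open>h(w s) = 0\<close> for all \<open>s \<in> (0,1]\<close>, and \<open>s \<rightarrow> 0\<close> contradicts \<open>h(0) \<noteq> 0\<close>.
\<close>
lemma weighted_norm_pos:
  assumes "\<nu> > 0"
    and I: "((\<lambda>s. s powr \<nu> * (norm (ent_J \<nu> (w * of_real s :: complex)))\<^sup>2) has_integral I) {0..1}"
  shows "I > 0"
proof (rule ccontr)
  assume "\<not> I > 0"
  moreover have "I \<ge> 0" by (rule has_integral_nonneg[OF I]) auto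
  ultimately have "I = 0" by simp
  define f where "f = (\<lambda>s. s powr \<nu> * (norm (ent_J \<nu> (w * of_real s :: complex)))\<^sup>2)"
  have "continuous_on {0..1} f"
    unfolding f_def using assms(1) by (intro continuous_intros continuous_on_powr_01) auto
  hence f0: "f s = 0" if "s \<in> {0..1}" for s
    using has_integral_0_cbox_imp_0[of 0 1 f s] I that \<open>I = 0\<close> unfolding f_def by auto
  hence z: "ent_J \<nu> (w * of_real s) = 0" if "s \<in> {0<..1}" for s
  proof -
    have "f s = 0" by (rule f0) (use that in auto)
    thus ?thesis using that by (simp add: f_def)
  qed
  have "isCont (ent_J \<nu>) (0::complex)"
    using ent_J_deriv[OF assms(1)] DERIV_isCont by blast
  moreover have "(\<lambda>n. w * of_real (1 / real (Suc n))) \<longlonglongrightarrow> w * of_real 0"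
    by (intro tendsto_intros LIMSEQ_inverse_real_of_nat[unfolded inverse_eq_divide])
  ultimately have "(\<lambda>n. ent_J \<nu> (w * of_real (1 / real (Suc n)))) \<longlonglongrightarrow> ent_J \<nu> 0"
    by (auto intro: isCont_tendsto_compose)
  moreover have "ent_J \<nu> (w * of_real (1 / real (Suc n))) = 0" for n
    by (rule z) auto
  ultimately have "ent_J \<nu> (0::complex) = 0" by (simp add: LIMSEQ_const_iff)
  thus False using ent_J_0_nonzero[OF assms(1)] by simp
qed

lemma ent_W_pos:
  assumes "\<nu> > 0" shows "ent_W \<nu> (x::real) > 0"
proof -
  have "((\<lambda>s. s powr \<nu> * (norm (ent_J \<nu> (of_real x * of_real s :: complex)))\<^sup>2) has_integral 2 * ent_W \<nu> x) {0..1}"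
    using weighted_norm_integral[OF assms, of x]
    by (simp flip: of_real_mult add: ent_J_of_real[OF assms])
  from weighted_norm_pos[OF assms this] show ?thesis by simp
qed

text \<open>
  At a zero of \<open>P\<close> the Riccati equation expresses the squared norm, which is positive, through
  \<open>h(A)\<close>.  This yields at once that zeros of \<open>P\<close> exceed \<open>\<nu>\<^sup>2\<close> and that they are simple.
\<close>
lemma ent_dJ_zero:
  fixes A :: real
  assumes "\<nu> > 0" "ent_dJ \<nu> A = 0"
  shows "A > \<nu>\<^sup>2" "ent_J \<nu> A \<noteq> 0" "ent_W \<nu> A = (A - \<nu>\<^sup>2) * (ent_J \<nu> A)\<^sup>2 / (2 * A)"
proof -
  have A: "A > 0" using ent_dJ_nonpos_arg(1)[OF assms(1), of A] assms(2) by force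
  have r: "2 * A * ent_W \<nu> A = (A - \<nu>\<^sup>2) * (ent_J \<nu> A)\<^sup>2"
    using ent_W_riccati[of A \<nu>] assms by simp
  have "2 * A * ent_W \<nu> A > 0" using ent_W_pos[OF assms(1)] A by simp
  thus "A > \<nu>\<^sup>2" "ent_J \<nu> A \<noteq> 0" unfolding r by (auto simp: zero_less_mult_iff)
  show "ent_W \<nu> A = (A - \<nu>\<^sup>2) * (ent_J \<nu> A)\<^sup>2 / (2 * A)" using r A by (simp add: field_simps)
qed

text \<open>
  The negative of the residue of \<open>h / P\<close> at a zero \<open>A\<close> of \<open>P\<close>.  It also equals \<open>h(A)\<^sup>2\<close> divided by half of the
  squared norm of \<open>s \<mapsto> h(A s)\<close>; this coincidence links Bessel's inequality to partial fractions.
\<close>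
definition pole_weight :: "real \<Rightarrow> real \<Rightarrow> real" where "pole_weight \<nu> A = 2 * A / (A - \<nu>\<^sup>2)"

text \<open>
  For \<open>u\<close> the conjugate of \<open>w\<close>, the integral is a squared norm, so \<open>Im (h / P)\<close> has the sign of \<open>Im w\<close>.
\<close>
lemma diagonal_kernel:
  assumes "\<nu> > 0" "Im w \<noteq> 0"
  shows "((\<lambda>s. of_real (s powr \<nu>) * ent_J \<nu> (w * of_real s) * cnj (ent_J \<nu> (w * of_real s))) has_integral
     of_real (2 * Im (ent_J \<nu> w * cnj (ent_dJ \<nu> w)) / Im w)) {0..1}"
proof -
  have ne: "w \<noteq> cnj w" using assms(2) by (metis Reals_cnj_iff complex_is_Real_iff)
  have "2 * (ent_J \<nu> w * ent_dJ \<nu> (cnj w) - ent_dJ \<nu> w * ent_J \<nu> (cnj w)) / (w - cnj w)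
     = 2 * (ent_J \<nu> w * cnj (ent_dJ \<nu> w) - cnj (ent_J \<nu> w * cnj (ent_dJ \<nu> w))) / (w - cnj w)"
    using assms by (simp add: ent_dJ_cnj ent_J_cnj)
  also have "\<dots> = of_real (2 * Im (ent_J \<nu> w * cnj (ent_dJ \<nu> w)) / Im w)"
    unfolding complex_diff_cnj using assms(2) by (simp add: field_simps)
  finally show ?thesis using ent_J_kernel[OF assms(1) ne] ent_J_cnj[OF assms(1), of "w * of_real _"]
    by simp
qed

text \<open>
  The operator behind the kernel is self-adjoint, so its eigenvalues, the zeros of \<open>P\<close>, are real:
  at a non-real one the squared norm of the eigenfunction would vanish.
\<close>
lemma ent_dJ_nonreal:
  assumes "\<nu> > 0" "Im w \<noteq> 0"
  shows "ent_dJ \<nu> w \<noteq> 0"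
proof
  assume "ent_dJ \<nu> w = 0"
  hence "((\<lambda>s. of_real (s powr \<nu> * (norm (ent_J \<nu> (w * of_real s)))\<^sup>2) :: complex) has_integral 0) {0..1}"
    using diagonal_kernel[OF assms] by (simp add: complex_norm_square mult.assoc del: of_real_power)
  from has_integral_Re[OF this]
  have "((\<lambda>s. s powr \<nu> * (norm (ent_J \<nu> (w * of_real s)))\<^sup>2) has_integral 0) {0..1}" by simp
  from weighted_norm_pos[OF assms(1) this] show False by simp
qed

text \<open>
  Bessel's inequality for \<open>s \<mapsto> h(w s)\<close> and the orthogonal functions \<open>s \<mapsto> h(A s)\<close>, \<open>A \<in> T\<close>, divided
  by \<open>|P(w)|\<^sup>2\<close>.  It is proved by integrating the squared modulus of the part \<open>g\<close> of \<open>h(w s)\<close> that is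
  orthogonal to these functions.
\<close>
lemma bessel_inequality:
  assumes "\<nu> > 0" "Im w \<noteq> 0" "finite T" and T: "\<And>A. A \<in> T \<Longrightarrow> ent_dJ \<nu> A = 0"
  shows "(\<Sum>A\<in>T. pole_weight \<nu> A / (norm (w - of_real A))\<^sup>2) \<le> Im (ent_J \<nu> w / ent_dJ \<nu> w) / Im w"
proof -
  define \<rho> where "\<rho> = (\<lambda>s::real. of_real (s powr \<nu>) :: complex)"
  define f where "f = (\<lambda>s::real. ent_J \<nu> (w * of_real s))"
  define e where "e = (\<lambda>A (s::real). ent_J \<nu> (of_real A * of_real s) :: complex)"
  \<comment> \<open>Fourier coefficients of \<open>f\<close>; \<open>2 * ent_W \<nu> A\<close> is the squared norm of \<open>e A\<close>.\<close>
  define \<alpha> where "\<alpha> = (\<lambda>A. - of_real (ent_J \<nu> A) * ent_dJ \<nu> w / ((w - of_real A) * of_real (ent_W \<nu> A)))"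
  define g where "g = (\<lambda>s. f s - (\<Sum>A\<in>T. \<alpha> A * e A s))"
  define Q where "Q = 2 * Im (ent_J \<nu> w * cnj (ent_dJ \<nu> w)) / Im w"
  have ne: "w \<noteq> of_real A" for A using assms(2) by auto
  have ne': "cnj w \<noteq> of_real A" for A using assms(2) by (metis complex_cnj_cnj complex_cnj_complex_of_real ne)
  have e_real: "e A s = of_real (ent_J \<nu> (A * s))" for A s
    using ent_J_of_real[OF assms(1), of "A * s", where 'a = complex] by (simp add: e_def)
  have E0: "ent_W \<nu> A \<noteq> 0" for A :: real using ent_W_pos[OF assms(1), of A] by simp
  have P0: "ent_dJ \<nu> (of_real A) = (0::complex)" if "A \<in> T" for A
    using T[OF that] ent_dJ_of_real[OF assms(1), of A, where 'a = complex] by simp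
  have fe: "((\<lambda>s. \<rho> s * f s * e A s) has_integral \<alpha> A * of_real (2 * ent_W \<nu> A)) {0..1}" if "A \<in> T" for A
  proof -
    have "\<alpha> A * of_real (2 * ent_W \<nu> A) = 2 * (ent_J \<nu> w * ent_dJ \<nu> (of_real A) - ent_dJ \<nu> w * ent_J \<nu> (of_real A)) / (w - of_real A)"
      using P0[OF that] E0[of A] ne[of A] ent_J_of_real[OF assms(1), of A, where 'a = complex]
      by (simp add: \<alpha>_def)
    thus ?thesis using ent_J_kernel[OF assms(1) ne[of A]]
      by (simp add: \<rho>_def f_def e_def)
  qed
  have ef: "((\<lambda>s. \<rho> s * e A s * cnj (f s)) has_integral cnj (\<alpha> A) * of_real (2 * ent_W \<nu> A)) {0..1}" if "A \<in> T" for A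
    using has_integral_cnj[THEN iffD2, OF fe[OF that]]
    by (simp add: \<rho>_def e_real mult_ac o_def)
  have ee: "((\<lambda>s. \<rho> s * e B s * e A s) has_integral (if A = B then of_real (2 * ent_W \<nu> A) else 0)) {0..1}"
    if "A \<in> T" "B \<in> T" for A B
  proof (cases "A = B")
    case True
    have "((\<lambda>s. of_real (s powr \<nu> * (ent_J \<nu> (A * s))\<^sup>2) :: complex) has_integral of_real (2 * ent_W \<nu> A)) {0..1}"
      by (rule has_integral_of_real[OF weighted_norm_integral[OF assms(1)]])
    thus ?thesis using True by (simp add: \<rho>_def e_real power2_eq_square mult_ac)
  next
    case False
    hence "(of_real B :: complex) \<noteq> of_real A" by simp
    from ent_J_kernel[OF assms(1) this] show ?thesis using False P0 that
      by (simp add: \<rho>_def e_def)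
  qed
  have ge: "((\<lambda>s. \<rho> s * g s * e A s) has_integral 0) {0..1}" if "A \<in> T" for A
  proof -
    have "((\<lambda>s. \<rho> s * f s * e A s - (\<Sum>B\<in>T. \<alpha> B * (\<rho> s * e B s * e A s))) has_integral
       (\<alpha> A * of_real (2 * ent_W \<nu> A) - (\<Sum>B\<in>T. \<alpha> B * (if A = B then of_real (2 * ent_W \<nu> A) else 0)))) {0..1}"
      by (intro has_integral_diff has_integral_sum has_integral_mult_right fe ee that assms(3))
    also have "(\<alpha> A * of_real (2 * ent_W \<nu> A) - (\<Sum>B\<in>T. \<alpha> B * (if A = B then of_real (2 * ent_W \<nu> A) else 0))) = 0"
      using that assms(3) by (simp add: if_distrib[of "(*) _"] cong: if_cong)
    also have "(\<lambda>s. \<rho> s * f s * e A s - (\<Sum>B\<in>T. \<alpha> B * (\<rho> s * e B s * e A s))) = (\<lambda>s. \<rho> s * g s * e A s)"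
      by (simp add: g_def fun_eq_iff left_diff_distrib right_diff_distrib sum_distrib_left sum_distrib_right mult_ac)
    finally show ?thesis .
  qed
  have ff: "((\<lambda>s. \<rho> s * f s * cnj (f s)) has_integral of_real Q) {0..1}"
    using diagonal_kernel[OF assms(1,2)] by (simp only: \<rho>_def f_def Q_def)
  have gf: "((\<lambda>s. \<rho> s * g s * cnj (f s)) has_integral
      of_real Q - (\<Sum>A\<in>T. \<alpha> A * (cnj (\<alpha> A) * of_real (2 * ent_W \<nu> A)))) {0..1}"
  proof -
    have "((\<lambda>s. \<rho> s * f s * cnj (f s) - (\<Sum>A\<in>T. \<alpha> A * (\<rho> s * e A s * cnj (f s)))) has_integral
      of_real Q - (\<Sum>A\<in>T. \<alpha> A * (cnj (\<alpha> A) * of_real (2 * ent_W \<nu> A)))) {0..1}"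
      by (intro has_integral_diff has_integral_sum has_integral_mult_right ff ef assms(3))
    also have "(\<lambda>s. \<rho> s * f s * cnj (f s) - (\<Sum>A\<in>T. \<alpha> A * (\<rho> s * e A s * cnj (f s)))) = (\<lambda>s. \<rho> s * g s * cnj (f s))"
      by (simp add: g_def fun_eq_iff left_diff_distrib right_diff_distrib sum_distrib_left sum_distrib_right mult_ac)
    finally show ?thesis .
  qed
  have "((\<lambda>s. \<rho> s * g s * cnj (f s) - (\<Sum>A\<in>T. cnj (\<alpha> A) * (\<rho> s * g s * e A s))) has_integral
      of_real Q - (\<Sum>A\<in>T. \<alpha> A * (cnj (\<alpha> A) * of_real (2 * ent_W \<nu> A))) - (\<Sum>A\<in>T. cnj (\<alpha> A) * 0)) {0..1}"
    by (intro has_integral_diff has_integral_sum has_integral_mult_right gf ge assms(3))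
  also have "(\<lambda>s. \<rho> s * g s * cnj (f s) - (\<Sum>A\<in>T. cnj (\<alpha> A) * (\<rho> s * g s * e A s))) = (\<lambda>s. of_real (s powr \<nu> * (norm (g s))\<^sup>2))"
  proof
    fix s
    have "cnj (g s) = cnj (f s) - (\<Sum>A\<in>T. cnj (\<alpha> A) * e A s)"
      by (simp add: g_def e_real)
    hence "\<rho> s * g s * cnj (f s) - (\<Sum>A\<in>T. cnj (\<alpha> A) * (\<rho> s * g s * e A s)) = \<rho> s * (g s * cnj (g s))"
      by (simp add: right_diff_distrib sum_distrib_left mult_ac)
    thus "\<rho> s * g s * cnj (f s) - (\<Sum>A\<in>T. cnj (\<alpha> A) * (\<rho> s * g s * e A s)) = of_real (s powr \<nu> * (norm (g s))\<^sup>2)"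
      by (simp only: \<rho>_def complex_norm_square[symmetric] of_real_mult)
  qed
  also have "of_real Q - (\<Sum>A\<in>T. \<alpha> A * (cnj (\<alpha> A) * of_real (2 * ent_W \<nu> A))) - (\<Sum>A\<in>T. cnj (\<alpha> A) * 0)
     = of_real (Q - (\<Sum>A\<in>T. (norm (\<alpha> A))\<^sup>2 * (2 * ent_W \<nu> A)))"
    by (simp add: mult.assoc[symmetric] complex_norm_square del: of_real_power)
  finally have "((\<lambda>s. s powr \<nu> * (norm (g s))\<^sup>2) has_integral
      (Q - (\<Sum>A\<in>T. (norm (\<alpha> A))\<^sup>2 * (2 * ent_W \<nu> A)))) {0..1}"
    by (drule_tac has_integral_Re) simp
  hence "Q - (\<Sum>A\<in>T. (norm (\<alpha> A))\<^sup>2 * (2 * ent_W \<nu> A)) \<ge> 0"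
    by (rule has_integral_nonneg) auto
  moreover have "(norm (\<alpha> A))\<^sup>2 * (2 * ent_W \<nu> A) = 2 * (norm (ent_dJ \<nu> w))\<^sup>2 * (pole_weight \<nu> A / (norm (w - of_real A))\<^sup>2)"
    if "A \<in> T" for A
  proof -
    note z = ent_dJ_zero[OF assms(1) T[OF that]]
    have "(norm (\<alpha> A))\<^sup>2 = (ent_J \<nu> A)\<^sup>2 * (norm (ent_dJ \<nu> w))\<^sup>2 / ((norm (w - of_real A))\<^sup>2 * (ent_W \<nu> A)\<^sup>2)"
      by (simp add: \<alpha>_def norm_mult norm_divide power_mult_distrib power_divide)
    hence "(norm (\<alpha> A))\<^sup>2 * (2 * ent_W \<nu> A) = 2 * (norm (ent_dJ \<nu> w))\<^sup>2 * ((ent_J \<nu> A)\<^sup>2 / ent_W \<nu> A) / (norm (w - of_real A))\<^sup>2"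
      using E0[of A] by (simp add: power2_eq_square mult_ac)
    also have "(ent_J \<nu> A)\<^sup>2 / ent_W \<nu> A = pole_weight \<nu> A"
      unfolding z(3) using z(2) by (simp add: pole_weight_def)
    finally show ?thesis by simp
  qed
  ultimately have "2 * (norm (ent_dJ \<nu> w))\<^sup>2 * (\<Sum>A\<in>T. pole_weight \<nu> A / (norm (w - of_real A))\<^sup>2) \<le> Q"
    by (simp add: sum_distrib_left)
  moreover have "Im (ent_J \<nu> w / ent_dJ \<nu> w) = Im (ent_J \<nu> w * cnj (ent_dJ \<nu> w)) / (norm (ent_dJ \<nu> w))\<^sup>2"
    by (subst complex_div_cnj) (simp flip: of_real_power)
  moreover have "(norm (ent_dJ \<nu> w))\<^sup>2 > 0" using ent_dJ_nonreal[OF assms(1,2)] by simp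
  ultimately have "2 * (norm (ent_dJ \<nu> w))\<^sup>2 * (\<Sum>A\<in>T. pole_weight \<nu> A / (norm (w - of_real A))\<^sup>2)
      \<le> 2 * (norm (ent_dJ \<nu> w))\<^sup>2 * (Im (ent_J \<nu> w / ent_dJ \<nu> w) / Im w)"
    by (simp add: Q_def del: times_complex.sel)
  thus ?thesis using ent_dJ_nonreal[OF assms(1,2)] by (subst (asm) mult_le_cancel_left_pos) auto
qed

section \<open>Functions on a disc that preserve the half-planes\<close>

lemma Re_of_real_mult: "Re (of_real a * z) = a * Re z"
  by simp

lemma abs_sin_mult_le: "\<bar>sin (real n * t)\<bar> \<le> real n * \<bar>sin t\<bar>"
proof (induction n)
  case (Suc n)
  have "sin (real (Suc n) * t) = sin (real n * t) * cos t + cos (real n * t) * sin t"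
    by (simp add: ring_distribs sin_add)
  also have "\<bar>\<dots>\<bar> \<le> \<bar>sin (real n * t)\<bar> * \<bar>cos t\<bar> + \<bar>cos (real n * t)\<bar> * \<bar>sin t\<bar>"
    by (rule order_trans[OF abs_triangle_ineq]) (simp add: abs_mult)
  also have "\<dots> \<le> \<bar>sin (real n * t)\<bar> * 1 + 1 * \<bar>sin t\<bar>"
    by (intro add_mono mult_mono) auto
  finally show ?case using Suc by (simp add: ring_distribs)
qed simp

text \<open>
  On a circle \<open>G\<close> has only Fourier modes of non-negative index, so the \<open>n\<close>-th sine coefficient of
  \<open>Im G\<close> for \<open>n \<ge> 1\<close> sees a single Taylor coefficient.
\<close>
lemma taylor_coeff_Im_integral:
  assumes G: "G holomorphic_on ball 0 R" and r: "0 < r" "r < R" and n: "n \<ge> 1"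
  shows "((\<lambda>t. sin (real n * t) * Im (G (of_real r * cis t))) has_integral
            pi * r ^ n * Re ((deriv ^^ n) G 0 / fact n)) {0..2 * pi}"
proof -
  have c: "continuous_on (cball 0 r) G" and h: "G holomorphic_on ball 0 r"
    using r by (auto intro!: holomorphic_on_imp_continuous_on holomorphic_on_subset[OF G])
  have "((\<lambda>u. G u / (u - 0) ^ Suc n) has_contour_integral 2 * pi * \<i> / fact n * (deriv ^^ n) G 0)
      (circlepath 0 r)"
    by (rule Cauchy_has_contour_integral_higher_derivative_circlepath[OF c h]) (use r in auto)
  hence "((\<lambda>t. G (of_real r * cis t) / (of_real r * cis t) ^ Suc n * r * \<i> * cis t) has_integral
      2 * pi * \<i> / fact n * (deriv ^^ n) G 0) {0..2 * pi}"
    by (simp add: circlepath_def has_contour_integral_part_circlepath_iff)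
  note A = has_integral_mult_right[OF this, of "of_real r ^ n / \<i>"]
  have "cis t ^ n * cis (- real n * t) = 1" for t
    by (simp add: Complex.DeMoivre cis_mult)
  hence "cis (- real n * t) = 1 / cis t ^ n" for t by (simp add: eq_divide_eq mult.commute)
  hence "complex_of_real r ^ n / \<i> * (G (of_real r * cis t) / (of_real r * cis t) ^ Suc n * r * \<i> * cis t)
       = G (of_real r * cis t) * cis (- real n * t)" for t
    using r by (simp add: power_mult_distrib mult_ac)
  moreover have "complex_of_real r ^ n / \<i> * (2 * pi * \<i> / fact n * (deriv ^^ n) G 0)
      = 2 * pi * of_real r ^ n * ((deriv ^^ n) G 0 / fact n)" (is "_ = ?I")
    by (simp add: mult_ac)
  ultimately have 1: "((\<lambda>t. G (of_real r * cis t) * cis (- real n * t)) has_integral ?I) {0..2 * pi}"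
    using A by (simp only:)
  have z: "(0::complex) ^ n = 0" using n by simp
  \<comment> \<open>The modes of negative index vanish: apply Cauchy to \<open>G u * u ^ n\<close> at \<open>0\<close>.\<close>
  have "((\<lambda>u. G u * u ^ n / (u - 0) ^ Suc 0) has_contour_integral
      2 * pi * \<i> / fact 0 * (deriv ^^ 0) (\<lambda>u. G u * u ^ n) 0) (circlepath 0 r)"
    by (rule Cauchy_has_contour_integral_higher_derivative_circlepath)
      (use r in \<open>auto intro!: continuous_intros holomorphic_intros c h\<close>)
  hence "((\<lambda>t. G (of_real r * cis t) * (of_real r * cis t) ^ n / (of_real r * cis t) * r * \<i> * cis t) has_integral 0)
      {0..2 * pi}"
    using z by (simp add: circlepath_def has_contour_integral_part_circlepath_iff)
  note B = has_integral_mult_right[OF this, of "1 / (\<i> * of_real r ^ n)"]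
  have "1 / (\<i> * of_real r ^ n) * (G (of_real r * cis t) * (of_real r * cis t) ^ n / (of_real r * cis t) * r * \<i> * cis t)
      = G (of_real r * cis t) * cis (real n * t)" for t
    using r by (simp add: power_mult_distrib mult_ac Complex.DeMoivre)
  hence 2: "((\<lambda>t. G (of_real r * cis t) * cis (real n * t)) has_integral 0) {0..2 * pi}"
    using B by (simp only: mult_zero_right)
  have "((\<lambda>t. - (1/2) * Re (G (of_real r * cis t) * cis (real n * t) - G (of_real r * cis t) * cis (- real n * t)))
     has_integral - (1/2) * Re (0 - ?I)) {0..2*pi}"
    by (rule has_integral_mult_right has_integral_Re has_integral_diff 1 2)+
  moreover have "- (1/2) * Re (z * cis (real n * t) - z * cis (- real n * t)) = sin (real n * t) * Im z" for z t
    by (simp add: algebra_simps)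
  moreover have "- (1/2) * Re (0 - ?I) = pi * r ^ n * Re ((deriv ^^ n) G 0 / fact n)"
  proof -
    have "?I = of_real (2 * pi * r ^ n) * ((deriv ^^ n) G 0 / fact n)" by simp
    hence "Re ?I = 2 * pi * r ^ n * Re ((deriv ^^ n) G 0 / fact n)" by (simp only: Re_of_real_mult)
    thus ?thesis unfolding minus_complex.sel by simp
  qed
  ultimately show ?thesis by (simp only:)
qed

text \<open>
  Compare the \<open>n\<close>-th sine coefficient of \<open>Im G\<close> with the first one: \<open>|sin (n t)| \<le> n |sin t|\<close>, and
  \<open>sin t\<close> times \<open>Im G\<close> is non-negative by assumption.
\<close>
lemma nevanlinna_coeff_bound:
  assumes G: "G holomorphic_on ball 0 R" and r: "0 < r" "r < R" and n: "n \<ge> 1"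
    and Im: "\<And>w. w \<in> ball 0 R \<Longrightarrow> Im (G w) * Im w \<ge> 0"
  shows "\<bar>Re ((deriv ^^ n) G 0 / fact n)\<bar> * r ^ n \<le> real n * (r * Re (deriv G 0))"
proof -
  have I1: "((\<lambda>t. sin t * Im (G (of_real r * cis t))) has_integral pi * r * Re (deriv G 0)) {0..2 * pi}"
    using taylor_coeff_Im_integral[OF G r, of 1] by simp
  note In = taylor_coeff_Im_integral[OF G r n]
  have le: "\<bar>sin (real n * t) * Im (G (of_real r * cis t))\<bar> \<le> real n * (sin t * Im (G (of_real r * cis t)))" for t
  proof -
    have "Im (G (of_real r * cis t)) * Im (of_real r * cis t) \<ge> 0"
      by (rule Im) (use r in \<open>auto simp: norm_mult\<close>)
    hence "r * (Im (G (of_real r * cis t)) * sin t) \<ge> 0"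
      by (simp add: mult_ac)
    hence "Im (G (of_real r * cis t)) * sin t \<ge> 0"
      using r by (simp only: zero_le_mult_iff) auto
    hence "sin t * Im (G (of_real r * cis t)) = \<bar>sin t\<bar> * \<bar>Im (G (of_real r * cis t))\<bar>"
      by (simp add: abs_mult[symmetric] mult.commute)
    thus ?thesis using mult_right_mono[OF abs_sin_mult_le[of n t], of "\<bar>Im (G (of_real r * cis t))\<bar>"]
      by (simp add: abs_mult mult.assoc)
  qed
  have "pi * r ^ n * Re ((deriv ^^ n) G 0 / fact n) \<le> real n * (pi * r * Re (deriv G 0))"
    by (rule has_integral_le[OF In has_integral_mult_right[OF I1]]) (use le abs_le_D1 in blast)
  moreover have "- (pi * r ^ n * Re ((deriv ^^ n) G 0 / fact n)) \<le> real n * (pi * r * Re (deriv G 0))"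
    by (rule has_integral_le[OF has_integral_neg[OF In] has_integral_mult_right[OF I1]]) (use le abs_le_D2 in blast)
  ultimately have "\<bar>pi * r ^ n * Re ((deriv ^^ n) G 0 / fact n)\<bar> \<le> real n * (pi * r * Re (deriv G 0))"
    by linarith
  hence "pi * (\<bar>Re ((deriv ^^ n) G 0 / fact n)\<bar> * r ^ n) \<le> pi * (real n * (r * Re (deriv G 0)))"
    using r by (simp add: abs_mult mult_ac)
  thus ?thesis by (simp only: mult_le_cancel_left_pos[OF pi_gt_zero])
qed

lemma summable_quadratic_geometric: "summable (\<lambda>m. (real m + 2)\<^sup>2 * (1 / 2) ^ m)"
proof (rule summable_ratio_test[where c = "3/4" and N = 3])
  fix m :: nat assume "m \<ge> 3"
  \<comment> \<open>\<open>2 (m + 3)\<^sup>2 \<le> 3 (m + 2)\<^sup>2\<close> amounts to \<open>m\<^sup>2 \<ge> 6\<close>.\<close>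
  hence "3 * 3 \<le> real m * real m" by (intro mult_mono) auto
  hence "2 * (real (Suc m) + 2)\<^sup>2 \<le> 3 * (real m + 2)\<^sup>2"
    by (simp add: power2_eq_square algebra_simps)
  hence "2 * (real (Suc m) + 2)\<^sup>2 * (1/2)^m \<le> 3 * (real m + 2)\<^sup>2 * (1/2)^m"
    by (rule mult_right_mono) auto
  thus "norm ((real (Suc m) + 2)\<^sup>2 * (1 / 2) ^ Suc m) \<le> 3 / 4 * norm ((real m + 2)\<^sup>2 * (1 / 2) ^ m)"
    by simp
qed auto

text \<open>
  The constant obtained by summing the coefficient bounds of the derivative over the disc of half
  the radius.
\<close>
definition quad_geom :: real where "quad_geom = (\<Sum>m. (real m + 2)\<^sup>2 * (1 / 2) ^ m)"

text \<open>
  The derivative of such a function is nearly constant near the centre of a large disc.  Letting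
  \<open>r \<rightarrow> \<infinity>\<close> recovers that an entire function of this kind is affine.
\<close>
lemma nevanlinna_deriv_bound:
  assumes G: "G holomorphic_on ball 0 R" and r: "0 < r" "r < R"
    and Im: "\<And>w. w \<in> ball 0 R \<Longrightarrow> Im (G w) * Im w \<ge> 0"
    and x: "\<bar>x\<bar> \<le> r / 2"
  shows "0 \<le> Re (deriv G 0)"
    and "\<bar>Re (deriv G (of_real x)) - Re (deriv G 0)\<bar> \<le> quad_geom * (\<bar>x\<bar> / r) * Re (deriv G 0)"
proof -
  define a where "a = (\<lambda>n. Re ((deriv ^^ n) G 0 / fact n))"
  define D where "D = Re (deriv G 0)"
  have "0 \<le> \<bar>a 1\<bar> * r ^ 1" using r by simp
  also have "\<dots> \<le> real 1 * (r * D)"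
    unfolding a_def D_def by (rule nevanlinna_coeff_bound[OF G r _ Im]) auto
  finally have D: "D \<ge> 0" using r by (simp add: zero_le_mult_iff)
  thus "0 \<le> Re (deriv G 0)" by (simp add: D_def)
  have "deriv G holomorphic_on ball 0 R" by (rule holomorphic_deriv[OF G]) auto
  moreover have xin: "of_real x \<in> ball (0::complex) R" using x r by simp
  ultimately have "(\<lambda>n. (deriv ^^ n) (deriv G) 0 / fact n * (of_real x - 0) ^ n) sums deriv G (of_real x)"
    by (rule holomorphic_power_series)
  hence "(\<lambda>n. Re ((deriv ^^ n) (deriv G) 0 / fact n * (of_real x - 0) ^ n)) sums Re (deriv G (of_real x))"
    by (rule sums_Re)
  also have "(\<lambda>n. Re ((deriv ^^ n) (deriv G) 0 / fact n * (of_real x - 0) ^ n))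
     = (\<lambda>n. real (Suc n) * a (Suc n) * x ^ n)"
  proof
    fix n
    have "(deriv ^^ n) (deriv G) 0 / fact n * (of_real x - 0) ^ n =
        of_real (real (Suc n) * x ^ n) * ((deriv ^^ Suc n) G 0 / fact (Suc n))"
      by (simp add: funpow_swap1 field_simps del: of_nat_Suc)
    thus "Re ((deriv ^^ n) (deriv G) 0 / fact n * (of_real x - 0) ^ n) = real (Suc n) * a (Suc n) * x ^ n"
      by (simp only: Re_of_real_mult a_def) (simp add: mult_ac)
  qed
  finally have S: "(\<lambda>n. real (Suc n) * a (Suc n) * x ^ n) sums Re (deriv G (of_real x))" .
  have "(\<lambda>n. real (Suc (Suc n)) * a (Suc (Suc n)) * x ^ Suc n) sums (Re (deriv G (of_real x)) - D)"
    using sums_Suc_iff[of "\<lambda>n. real (Suc n) * a (Suc n) * x ^ n" "Re (deriv G (of_real x)) - D"] S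
    by (simp add: a_def D_def)
  moreover have "(\<lambda>m. (\<bar>x\<bar> / r) * D * ((real m + 2)\<^sup>2 * (1 / 2) ^ m)) sums ((\<bar>x\<bar> / r) * D * quad_geom)"
    unfolding quad_geom_def by (intro sums_mult summable_sums summable_quadratic_geometric)
  moreover have "norm (real (Suc (Suc n)) * a (Suc (Suc n)) * x ^ Suc n)
      \<le> (\<bar>x\<bar> / r) * D * ((real n + 2)\<^sup>2 * (1 / 2) ^ n)" for n
  proof -
    have *: "\<bar>a (Suc (Suc n))\<bar> * r ^ Suc (Suc n) \<le> real (Suc (Suc n)) * (r * D)"
      unfolding a_def D_def by (rule nevanlinna_coeff_bound[OF G r _ Im]) auto
    have **: "\<bar>a (Suc (Suc n))\<bar> \<le> real (Suc (Suc n)) * D / r ^ Suc n"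
    proof -
      have "r * (\<bar>a (Suc (Suc n))\<bar> * r ^ Suc n) \<le> r * (real (Suc (Suc n)) * D)"
        using * by (simp only: power_Suc mult_ac)
      hence "\<bar>a (Suc (Suc n))\<bar> * r ^ Suc n \<le> real (Suc (Suc n)) * D"
        using r by (simp only: mult_le_cancel_left_pos)
      thus ?thesis using r by (simp only: pos_le_divide_eq zero_less_power)
    qed
    have "norm (real (Suc (Suc n)) * a (Suc (Suc n)) * x ^ Suc n)
       = real (Suc (Suc n)) * \<bar>x\<bar> ^ Suc n * \<bar>a (Suc (Suc n))\<bar>"
      by (simp add: abs_mult power_abs mult_ac del: of_nat_Suc)
    also have "\<dots> \<le> real (Suc (Suc n)) * \<bar>x\<bar> ^ Suc n * (real (Suc (Suc n)) * D / r ^ Suc n)"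
      by (intro mult_left_mono **) auto
    also have "\<dots> = (\<bar>x\<bar> / r) * D * (real n + 2)\<^sup>2 * (\<bar>x\<bar> / r) ^ n"
      by (simp add: power_divide power2_eq_square field_simps)
    also have "\<dots> \<le> (\<bar>x\<bar> / r) * D * (real n + 2)\<^sup>2 * (1 / 2) ^ n"
      by (intro mult_left_mono power_mono) (use x r D in \<open>auto simp: field_simps\<close>)
    finally show ?thesis by (simp add: mult.assoc)
  qed
  ultimately have "\<bar>Re (deriv G (of_real x)) - D\<bar> \<le> (\<bar>x\<bar> / r) * D * quad_geom"
    by (smt (verit, best) norm_suminf_le sums_iff real_norm_def)
  thus "\<bar>Re (deriv G (of_real x)) - Re (deriv G 0)\<bar> \<le> quad_geom * (\<bar>x\<bar> / r) * Re (deriv G 0)"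
    by (simp add: D_def mult_ac)
qed

lemma holomorphic_extend_finite:
  assumes "finite T" "open S" "f holomorphic_on S - T" "T \<subseteq> S"
    and "\<And>a. a \<in> T \<Longrightarrow> ((\<lambda>z. (z - a) * f z) \<longlongrightarrow> 0) (at a)"
  shows "\<exists>g. g holomorphic_on S \<and> (\<forall>z\<in>S - T. g z = f z)"
  using assms
proof (induction T arbitrary: S rule: finite_induct)
  case empty thus ?case by auto
next
  case (insert a T)
  have "S - insert a T = (S - {a}) - T" by blast
  hence "f holomorphic_on (S - {a}) - T" using insert.prems(2) by simp
  moreover have "open (S - {a})" using insert.prems(1) by (rule open_delete)
  moreover have "T \<subseteq> S - {a}" using insert.prems(3) insert.hyps(2) by blast
  ultimately obtain g where g: "g holomorphic_on S - {a}" "\<forall>z\<in>S - {a} - T. g z = f z"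
    using insert.IH[of "S - {a}"] insert.prems(4) by blast
  have "((\<lambda>z. (z - a) * g z) \<longlongrightarrow> 0) (at a)"
  proof (rule Lim_transform_eventually)
    show "((\<lambda>z. (z - a) * f z) \<longlongrightarrow> 0) (at a)" using insert.prems by simp
    have "open (S - T)" using insert by (simp add: finite_imp_closed open_Diff)
    hence "eventually (\<lambda>z. z \<in> S - T) (at a)"
      using insert by (intro eventually_at_in_open') auto
    moreover have "eventually (\<lambda>z. z \<noteq> a) (at a)" by (simp add: eventually_at_filter)
    ultimately show "eventually (\<lambda>z. (z - a) * f z = (z - a) * g z) (at a)"
      by eventually_elim (use g in auto)
  qed
  moreover have "a \<in> interior S" using insert by (simp add: interior_open)
  ultimately have "\<exists>k. k holomorphic_on S \<and> (\<forall>z\<in>S - {a}. k z = g z)"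
    by (simp only: holomorphic_on_extend_lim[OF g(1)])
  then obtain k where k: "k holomorphic_on S" "\<forall>z\<in>S - {a}. k z = g z"
    by blast
  have "k z = f z" if "z \<in> S - insert a T" for z
    using k(2) g(2) that by simp
  thus ?case using k(1) by blast
qed

section \<open>The partial fraction expansion\<close>

lemma ent_dJ_deriv_at_zero:
  assumes "\<nu> > 0" "ent_dJ \<nu> (A::real) = 0"
  shows "(ent_dJ \<nu> has_field_derivative of_real (- ent_J \<nu> A / pole_weight \<nu> A)) (at (of_real A :: complex))"
proof -
  note z = ent_dJ_zero[OF assms]
  have A: "A > 0" "A - \<nu>\<^sup>2 > 0" using z(1) zero_le_power2[of \<nu>] by linarith+
  have "A * ent_J (\<nu> + 1) A = 2 * \<nu> * ent_J \<nu> A" using assms(2) by (simp add: ent_dJ_def)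
  hence h1: "ent_J (\<nu> + 1) A = 2 * \<nu> * ent_J \<nu> A / A" using A by (simp add: field_simps)
  have "\<nu> * ent_J (\<nu> + 1) A / 4 - ent_J \<nu> A / 2 = - ent_J \<nu> A / pole_weight \<nu> A"
    unfolding h1 pole_weight_def using A by (simp add: field_simps power2_eq_square)
  hence "(of_real (\<nu> * ent_J (\<nu> + 1) A / 4 - ent_J \<nu> A / 2) :: complex) = of_real (- ent_J \<nu> A / pole_weight \<nu> A)"
    by (rule arg_cong)
  thus ?thesis using ent_dJ_deriv[OF assms(1), of "of_real A :: complex"] assms(1)
    by (simp add: ent_J_of_real)
qed

text \<open>
  The sign of the terms corresponds to residue \<open>- pole_weight \<nu> A\<close> of \<open>h / P\<close> at \<open>A\<close>.
\<close>
definition remainder :: "real \<Rightarrow> real set \<Rightarrow> complex \<Rightarrow> complex" where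
  "remainder \<nu> T w = ent_J \<nu> w / ent_dJ \<nu> w - (\<Sum>A\<in>T. of_real (pole_weight \<nu> A) / (of_real A - w))"

lemma ent_dJ_zeros_real:
  assumes "\<nu> > 0" "ent_dJ \<nu> (w::complex) = 0"
  shows "\<exists>A. w = of_real A \<and> ent_dJ \<nu> A = 0"
proof -
  have "Im w = 0" using ent_dJ_nonreal[OF assms(1)] assms(2) by blast
  hence w: "w = of_real (Re w)" by (simp add: complex_eq_iff)
  moreover have "ent_dJ \<nu> (Re w) = 0"
    using assms ent_dJ_of_real[OF assms(1), of "Re w", where 'a = complex] w by simp
  ultimately show ?thesis by blast
qed

text \<open>
  The simple pole of \<open>h / P\<close> cancels against its principal part, since \<open>h / P'\<close> is \<open>- pole_weight \<nu> B\<close> at \<open>B\<close>.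
\<close>
lemma remainder_residue:
  assumes "\<nu> > 0" "finite T" and T: "\<And>A. A \<in> T \<Longrightarrow> ent_dJ \<nu> A = 0" and B: "B \<in> T"
  shows "((\<lambda>w. (w - of_real B) * remainder \<nu> T w) \<longlongrightarrow> 0) (at (of_real B))"
proof -
  define b where "b = (of_real B :: complex)"
  note z = ent_dJ_zero[OF assms(1) T[OF B]]
  have c0: "pole_weight \<nu> B \<noteq> 0" 
  proof -
    have "B > 0" "B - \<nu>\<^sup>2 > 0" using z(1) zero_le_power2[of \<nu>] by linarith+
    thus ?thesis by (simp add: pole_weight_def)
  qed
  have Pb: "ent_dJ \<nu> b = 0" using ent_dJ_of_real[OF assms(1), of B, where 'a = complex] T[OF B] by (simp add: b_def)
  have hb: "ent_J \<nu> b = of_real (ent_J \<nu> B)" by (simp add: b_def ent_J_of_real assms(1))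
  have d: "((\<lambda>w. (ent_dJ \<nu> w - ent_dJ \<nu> b) / (w - b)) \<longlongrightarrow> of_real (- ent_J \<nu> B / pole_weight \<nu> B)) (at b)"
    using ent_dJ_deriv_at_zero[OF assms(1) T[OF B]] unfolding b_def has_field_derivative_iff .
  have "isCont (ent_J \<nu>) b" using ent_J_deriv[OF assms(1)] DERIV_isCont by blast
  hence h: "(ent_J \<nu> \<longlongrightarrow> of_real (ent_J \<nu> B)) (at b)" using hb by (simp add: isCont_def)
  have s: "((\<lambda>w. (w - b) / (of_real A - w)) \<longlongrightarrow> (if A = B then -1 else 0)) (at b)" for A
  proof (cases "A = B")
    case True
    have "eventually (\<lambda>w. -1 = (w - b) / (of_real A - w)) (at b)"
      unfolding eventually_at_filter using True
      by (intro always_eventually allI impI) (simp add: b_def field_simps)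
    thus ?thesis using True by (simp add: Lim_transform_eventually[OF tendsto_const])
  next
    case False
    hence "of_real A \<noteq> b" by (simp add: b_def)
    hence "((\<lambda>w. (w - b) / (of_real A - w)) \<longlongrightarrow> (b - b) / (of_real A - b)) (at b)"
      by (intro tendsto_intros) auto
    thus ?thesis using False by simp
  qed
  have "((\<lambda>w. ent_J \<nu> w / ((ent_dJ \<nu> w - ent_dJ \<nu> b) / (w - b)) - (\<Sum>A\<in>T. of_real (pole_weight \<nu> A) * ((w - b) / (of_real A - w))))
      \<longlongrightarrow> of_real (ent_J \<nu> B) / of_real (- ent_J \<nu> B / pole_weight \<nu> B) - (\<Sum>A\<in>T. of_real (pole_weight \<nu> A) * (if A = B then -1 else 0))) (at b)"
    by (intro tendsto_intros h d s) (use z c0 in auto)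
  also have "of_real (ent_J \<nu> B) / of_real (- ent_J \<nu> B / pole_weight \<nu> B) - (\<Sum>A\<in>T. of_real (pole_weight \<nu> A) * (if A = B then -1 else 0)) = (0::complex)"
    using z(2) c0 B assms(2) by (simp add: if_distrib[of "(*) _"] cong: if_cong)
  finally show ?thesis unfolding b_def[symmetric]
  proof (rule Lim_transform_eventually)
    show "\<forall>\<^sub>F w in at b. ent_J \<nu> w / ((ent_dJ \<nu> w - ent_dJ \<nu> b) / (w - b)) -
        (\<Sum>A\<in>T. of_real (pole_weight \<nu> A) * ((w - b) / (of_real A - w))) = (w - b) * remainder \<nu> T w"
      unfolding eventually_at_filter
      by (intro always_eventually allI impI)
        (simp add: remainder_def Pb right_diff_distrib sum_distrib_left mult_ac)
  qed
qed

text \<open>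
  Poles in \<open>T\<close> outside the disc only contribute terms that are holomorphic in the disc.
\<close>
lemma remainder_extension:
  assumes "\<nu> > 0" "finite T" and T: "\<And>A. A \<in> T \<Longrightarrow> ent_dJ \<nu> A = 0"
    and R: "\<And>A. ent_dJ \<nu> A = 0 \<Longrightarrow> A < R \<Longrightarrow> A \<in> T"
  shows "\<exists>G. G holomorphic_on ball 0 R \<and> (\<forall>w\<in>ball 0 R - of_real ` T. G w = remainder \<nu> T w)"
proof -
  define T' where "T' = of_real ` T \<inter> ball (0::complex) R"
  have "\<exists>G. G holomorphic_on ball 0 R \<and> (\<forall>w\<in>ball 0 R - T'. G w = remainder \<nu> T w)"
  proof (rule holomorphic_extend_finite)
    show "finite T'" "T' \<subseteq> ball 0 R" using assms(2) by (auto simp: T'_def)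
    have "ent_dJ \<nu> w \<noteq> 0" if w: "w \<in> ball 0 R - T'" for w
    proof
      assume "ent_dJ \<nu> w = 0"
      then obtain A where A: "w = of_real A" "ent_dJ \<nu> A = 0" using ent_dJ_zeros_real[OF assms(1)] by blast
      hence "A < R" using w by auto
      thus False using R[OF A(2)] A(1) w by (auto simp: T'_def)
    qed
    moreover have "of_real A - w \<noteq> 0" if "w \<in> ball 0 R - T'" "A \<in> T" for w A
      using that by (auto simp: T'_def)
    moreover have "ent_J \<nu> holomorphic_on S" "ent_dJ \<nu> holomorphic_on S" for S :: "complex set"
      unfolding holomorphic_on_def field_differentiable_def
      using has_field_derivative_at_within[OF ent_J_deriv[OF assms(1)]]
        has_field_derivative_at_within[OF ent_dJ_deriv[OF assms(1)]] by blast+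
    ultimately show "remainder \<nu> T holomorphic_on ball 0 R - T'"
      unfolding remainder_def[abs_def] by (intro holomorphic_intros) auto
    fix a assume "a \<in> T'"
    then obtain B where "a = of_real B" "B \<in> T" by (auto simp: T'_def)
    thus "((\<lambda>z. (z - a) * remainder \<nu> T z) \<longlongrightarrow> 0) (at a)"
      using remainder_residue[OF assms(1-3)] by simp
  qed auto
  moreover have "ball 0 R - T' = ball 0 R - of_real ` T" by (auto simp: T'_def)
  ultimately show ?thesis by simp
qed

text \<open>
  This is exactly Bessel's inequality, since \<open>Im (c / (A - w)) = c Im w / |w - A|\<^sup>2\<close>.
\<close>
lemma remainder_Im:
  assumes "\<nu> > 0" "finite T" and T: "\<And>A. A \<in> T \<Longrightarrow> ent_dJ \<nu> A = 0" and w: "Im w \<noteq> 0"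
  shows "Im (remainder \<nu> T w) * Im w \<ge> 0"
proof -
  have "Im (of_real (pole_weight \<nu> A) / (of_real A - w)) = pole_weight \<nu> A / (norm (w - of_real A))\<^sup>2 * Im w" for A
    by (simp add: Im_divide norm_minus_commute cmod_power2 flip: power2_eq_square)
       (simp add: power2_eq_square algebra_simps)
  hence "Im (remainder \<nu> T w) = Im (ent_J \<nu> w / ent_dJ \<nu> w) - (\<Sum>A\<in>T. pole_weight \<nu> A / (norm (w - of_real A))\<^sup>2) * Im w"
    by (simp add: remainder_def sum_distrib_right)
  hence "Im (remainder \<nu> T w) * Im w =
      (Im (ent_J \<nu> w / ent_dJ \<nu> w) / Im w - (\<Sum>A\<in>T. pole_weight \<nu> A / (norm (w - of_real A))\<^sup>2)) * (Im w)\<^sup>2"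
  proof -
    have "(X - S * Im w) * Im w = (X / Im w - S) * (Im w)\<^sup>2" for X S
      using w by (simp add: left_diff_distrib power2_eq_square)
    thus ?thesis by (simp only: \<open>Im (remainder \<nu> T w) = _\<close>)
  qed
  also have "\<dots> \<ge> 0"
    using bessel_inequality[OF assms(1) w assms(2) T] by simp
  finally show ?thesis .
qed

text \<open>
  The derivative of \<open>remainder\<close> on the real axis, as a real function.
\<close>
definition defect :: "real \<Rightarrow> real set \<Rightarrow> real \<Rightarrow> real" where
  "defect \<nu> T x = ent_W \<nu> x / (ent_dJ \<nu> x)\<^sup>2 - (\<Sum>A\<in>T. pole_weight \<nu> A / (A - x)\<^sup>2)"

lemma remainder_deriv:
  assumes "\<nu> > 0" "finite T" and T: "\<And>A. A \<in> T \<Longrightarrow> ent_dJ \<nu> A = 0" and x: "ent_dJ \<nu> x \<noteq> 0"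
  shows "(remainder \<nu> T has_field_derivative of_real (defect \<nu> T x)) (at (of_real x))"
proof -
  have Px: "ent_dJ \<nu> (of_real x) \<noteq> (0::complex)" using x assms(1) by (simp add: ent_dJ_of_real)
  have ne: "of_real A - of_real x \<noteq> (0::complex)" if "A \<in> T" for A using T[OF that] x by auto
  have "((\<lambda>w. of_real (pole_weight \<nu> A) / (of_real A - w)) has_field_derivative
     of_real (pole_weight \<nu> A) / (of_real A - of_real x)\<^sup>2) (at (of_real x))" if "A \<in> T" for A
    using ne[OF that] by (auto intro!: derivative_eq_intros simp: power2_eq_square)
  hence "(remainder \<nu> T has_field_derivative ent_W \<nu> (of_real x) / (ent_dJ \<nu> (of_real x))\<^sup>2 -
     (\<Sum>A\<in>T. of_real (pole_weight \<nu> A) / (of_real A - of_real x)\<^sup>2)) (at (of_real x))"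
    unfolding remainder_def[abs_def]
    by (intro DERIV_diff ent_ratio_deriv assms(1) Px DERIV_sum)
  thus ?thesis by (simp add: defect_def ent_W_of_real ent_dJ_of_real assms(1))
qed

lemma defect_flat:
  assumes "\<nu> > 0" "finite T" and T: "\<And>A. A \<in> T \<Longrightarrow> ent_dJ \<nu> A = 0"
    and R: "\<And>A. ent_dJ \<nu> A = 0 \<Longrightarrow> A < R \<Longrightarrow> A \<in> T"
    and r: "0 < r" "r < R" and x: "\<bar>x\<bar> \<le> r / 2" "ent_dJ \<nu> x \<noteq> 0"
  shows "0 \<le> defect \<nu> T 0"
    and "\<bar>defect \<nu> T x - defect \<nu> T 0\<bar> \<le> quad_geom * (\<bar>x\<bar> / r) * defect \<nu> T 0"
proof -
  obtain G where G: "G holomorphic_on ball 0 R" "\<And>w. w \<in> ball 0 R - of_real ` T \<Longrightarrow> G w = remainder \<nu> T w"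
    using remainder_extension[OF assms(1-4)] by blast
  have "closed (of_real ` T :: complex set)" using assms(2) by (simp add: finite_imp_closed)
  hence op: "open (ball 0 R - of_real ` T :: complex set)" by (simp add: open_Diff)
  have dG: "deriv G (of_real y) = of_real (defect \<nu> T y)" if y: "ent_dJ \<nu> y \<noteq> 0" "\<bar>y\<bar> < R" for y
  proof -
    have "of_real y \<in> ball 0 R - (of_real ` T :: complex set)" using T y by auto
    hence "(G has_field_derivative of_real (defect \<nu> T y)) (at (of_real y))"
      using has_field_derivative_transform_within_open[OF remainder_deriv[OF assms(1-3) y(1)] op] G(2) by metis
    thus ?thesis by (rule DERIV_imp_deriv)
  qed
  have Im: "Im (G w) * Im w \<ge> 0" if "w \<in> ball 0 R" for w
  proof (cases "Im w = 0")
    case False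
    hence "w \<notin> of_real ` T" by auto
    thus ?thesis using G(2) that remainder_Im[OF assms(1-3) False] by simp
  qed simp
  have P0: "ent_dJ \<nu> (0::real) \<noteq> 0" using ent_dJ_nonpos_arg(1)[OF assms(1), of 0] by simp
  have d0: "Re (deriv G 0) = defect \<nu> T 0" using dG[OF P0] r by simp
  have dx: "Re (deriv G (of_real x)) = defect \<nu> T x" using dG[OF x(2)] x(1) r by simp
  show "0 \<le> defect \<nu> T 0"
    and "\<bar>defect \<nu> T x - defect \<nu> T 0\<bar> \<le> quad_geom * (\<bar>x\<bar> / r) * defect \<nu> T 0"
    using nevanlinna_deriv_bound[OF G(1) r Im x(1)] unfolding d0 dx by auto
qed

lemma pole_weight_pos: "\<nu> > 0 \<Longrightarrow> ent_dJ \<nu> A = 0 \<Longrightarrow> pole_weight \<nu> A > 0"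
  using ent_dJ_zero(1)[of \<nu> A] le_less_trans[OF zero_le_power2, of \<nu> A]
  by (auto simp: pole_weight_def intro!: divide_pos_pos)

text \<open>
  The defect at \<open>0\<close> decreases along \<open>T\<close> and is non-negative, hence converges to some \<open>\<beta> \<ge> 0\<close>.
  By \<open>defect_flat\<close> the defect at any other point has the same limit.  On the negative axis this
  forces \<open>M' \<ge> \<beta>\<close>, and boundedness of \<open>M\<close> there gives \<open>\<beta> = 0\<close>.  The family \<open>T\<close> may be eventually
  constant, so that the lemma also covers a finite set of poles.
\<close>
lemma partial_fractions_limit:
  fixes T :: "nat \<Rightarrow> real set" and R :: "nat \<Rightarrow> real"
  assumes nu: "\<nu> > 0" and fin: "\<And>i. finite (T i)" and inc: "incseq T"
    and T: "\<And>i A. A \<in> T i \<Longrightarrow> ent_dJ \<nu> A = 0"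
    and R: "\<And>i A. ent_dJ \<nu> A = 0 \<Longrightarrow> A < R i \<Longrightarrow> A \<in> T i"
    and Rlim: "filterlim R at_top sequentially"
    and x: "ent_dJ \<nu> x \<noteq> 0"
  shows "(\<lambda>i. \<Sum>A\<in>T i. pole_weight \<nu> A / (A - x)\<^sup>2) \<longlonglongrightarrow> ent_W \<nu> x / (ent_dJ \<nu> x)\<^sup>2"
proof -
  have P0: "ent_dJ \<nu> y > 0" if "y \<le> 0" for y :: real using ent_dJ_nonpos_arg(1)[OF nu that] .
  define S where "S = (\<lambda>i x. \<Sum>A\<in>T i. pole_weight \<nu> A / (A - x)\<^sup>2)"
  have S_nonneg: "S i y \<ge> 0" for i y
    unfolding S_def using pole_weight_pos[OF nu T] by (intro sum_nonneg) (simp add: less_imp_le)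
  have d_nonneg: "defect \<nu> (T i) 0 \<ge> 0" if "R i > 0" for i
    by (rule defect_flat(1)[where R = "R i" and r = "R i / 2" and x = 0])
      (use that P0[of 0] nu fin T R in auto)
  have Sinc: "incseq (\<lambda>i. S i 0)"
    unfolding incseq_def S_def using inc fin pole_weight_pos[OF nu T]
    by (intro allI impI sum_mono2) (auto simp: incseq_def less_imp_le)
  have Sbd: "S i 0 \<le> ent_W \<nu> 0 / (ent_dJ \<nu> 0)\<^sup>2" for i
  proof -
    have "eventually (\<lambda>j. R j > 0 \<and> i \<le> j) sequentially"
      using Rlim by (intro eventually_conj eventually_ge_at_top) (simp add: filterlim_at_top_dense)
    then obtain j where "R j > 0" "i \<le> j" by (auto dest: eventually_happens)
    moreover have "S i 0 \<le> S j 0" using Sinc \<open>i \<le> j\<close> by (simp add: incseq_def)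
    ultimately show ?thesis using d_nonneg[of j] by (simp add: defect_def S_def)
  qed
  obtain s where s: "(\<lambda>i. S i 0) \<longlonglongrightarrow> s"
    using incseq_convergent[OF Sinc allI[OF Sbd]] by blast
  define \<beta> where "\<beta> = ent_W \<nu> 0 / (ent_dJ \<nu> 0)\<^sup>2 - s"
  have d0: "(\<lambda>i. defect \<nu> (T i) 0) \<longlonglongrightarrow> \<beta>"
    using tendsto_diff[OF tendsto_const s] unfolding defect_def \<beta>_def S_def .
  have "0 \<le> \<beta>"
    using d0 by (rule tendsto_lowerbound)
      (use Rlim d_nonneg in \<open>auto simp: filterlim_at_top_dense elim!: allE[of _ 0] eventually_mono\<close>)
  have dy: "(\<lambda>i. defect \<nu> (T i) y) \<longlonglongrightarrow> \<beta>" if y: "ent_dJ \<nu> y \<noteq> 0" for y :: real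
  proof -
    have "eventually (\<lambda>i. R i > 4 * \<bar>y\<bar>) sequentially"
      using Rlim by (simp add: filterlim_at_top_dense)
    hence E1: "eventually (\<lambda>i. norm (defect \<nu> (T i) y - defect \<nu> (T i) 0)
        \<le> quad_geom * (\<bar>y\<bar> / (R i / 2)) * defect \<nu> (T i) 0) sequentially"
    proof eventually_elim
      case (elim i)
      hence "R i > 0" by linarith
      thus ?case unfolding real_norm_def
        by (intro defect_flat(2)[where R = "R i"]) (use y elim nu fin T R in auto)
    qed
    have E2: "(\<lambda>i. quad_geom * (\<bar>y\<bar> / (R i / 2)) * defect \<nu> (T i) 0) \<longlonglongrightarrow> quad_geom * 0 * \<beta>"
    proof (intro tendsto_intros d0)
      have "(\<lambda>i. (2 * \<bar>y\<bar>) / R i) \<longlonglongrightarrow> 0"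
        by (rule tendsto_divide_0[OF tendsto_const]) (use Rlim filterlim_at_top_imp_at_infinity in blast)
      thus "(\<lambda>i. \<bar>y\<bar> / (R i / 2)) \<longlonglongrightarrow> 0" by (simp add: mult.commute)
    qed
    have "(\<lambda>i. defect \<nu> (T i) y - defect \<nu> (T i) 0) \<longlonglongrightarrow> 0"
      by (rule Lim_null_comparison[OF E1 E2[unfolded mult_zero_right mult_zero_left]])
    from tendsto_add[OF this d0] show ?thesis by simp
  qed
  have lower: "\<beta> \<le> ent_W \<nu> y / (ent_dJ \<nu> y)\<^sup>2" if "y \<le> 0" for y :: real
  proof (rule tendsto_upperbound[OF dy])
    show "ent_dJ \<nu> y \<noteq> 0" using P0[OF that] by simp
    show "\<forall>\<^sub>F i in sequentially. defect \<nu> (T i) y \<le> ent_W \<nu> y / (ent_dJ \<nu> y)\<^sup>2"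
      using S_nonneg[of _ y] by (simp add: defect_def S_def)
  qed auto
  have "\<beta> \<le> 0"
  proof (rule ccontr)
    assume "\<not> \<beta> \<le> 0"
    hence b: "\<beta> > 0" by simp
    \<comment> \<open>Over an interval of length \<open>t\<close> the growth would be at least \<open>t * \<beta> = 2 / \<nu>\<close>, twice what is possible.\<close>
    define t where "t = 2 / (\<nu> * \<beta>)"
    have t: "t > 0" using b nu by (simp add: t_def)
    have "\<exists>z>-t. z < 0 \<and> ent_J \<nu> 0 / ent_dJ \<nu> 0 - ent_J \<nu> (-t) / ent_dJ \<nu> (-t) = (0 - (-t)) * (ent_W \<nu> z / (ent_dJ \<nu> z)\<^sup>2)"
      by (rule MVT2) (use t P0 in \<open>auto intro!: ent_ratio_deriv[OF nu] simp: less_imp_neq[symmetric]\<close>)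
    then obtain z where z: "z < 0" "ent_J \<nu> 0 / ent_dJ \<nu> 0 - ent_J \<nu> (-t) / ent_dJ \<nu> (-t) = t * (ent_W \<nu> z / (ent_dJ \<nu> z)\<^sup>2)"
      by auto
    have "t * \<beta> \<le> t * (ent_W \<nu> z / (ent_dJ \<nu> z)\<^sup>2)" using lower[of z] z t by (intro mult_left_mono) auto
    also have "\<dots> \<le> 1 / \<nu>"
      using z(2) ent_dJ_nonpos_arg(2)[OF nu, of 0] ent_J_pos[OF nu, of "-t"] P0[of "-t"] t
        divide_pos_pos[of "ent_J \<nu> (-t)" "ent_dJ \<nu> (-t)"] by linarith
    finally show False using b nu by (simp add: t_def field_simps)
  qed
  with \<open>0 \<le> \<beta>\<close> have "\<beta> = 0" by simp
  have "(\<lambda>i. ent_W \<nu> x / (ent_dJ \<nu> x)\<^sup>2 - defect \<nu> (T i) x) \<longlonglongrightarrow> ent_W \<nu> x / (ent_dJ \<nu> x)\<^sup>2 - 0"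
    using dy[OF x] \<open>\<beta> = 0\<close> by (intro tendsto_intros) auto
  thus ?thesis by (simp add: defect_def)
qed

text \<open>
  With finitely many poles, \<open>M(-t) = l + u(t)\<close> for a constant \<open>l\<close> and a finite sum \<open>u\<close> of simple fractions.
  As \<open>t \<rightarrow> \<infinity>\<close>, the Riccati equation requires \<open>(t + \<nu>\<^sup>2) (l + u(t))\<^sup>2 \<rightarrow> 1\<close>.  So \<open>l = 0\<close>; but then \<open>u(t)\<close> is of
  order \<open>1/t\<close> and the limit is \<open>0\<close>.
\<close>
lemma infinite_ent_dJ_zeros:
  assumes nu: "\<nu> > 0"
  shows "infinite {A::real. ent_dJ \<nu> A = 0}"
proof
  define Z where "Z = {A::real. ent_dJ \<nu> A = 0}"
  assume "finite {A::real. ent_dJ \<nu> A = 0}"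
  hence fin: "finite Z" by (simp add: Z_def)
  have Zpos: "A > 0" if "A \<in> Z" for A
    using le_less_trans[OF zero_le_power2 ent_dJ_zero(1)[OF nu, of A]] that by (simp add: Z_def)
  have P0: "ent_dJ \<nu> y > 0" if "y \<le> 0" for y :: real using ent_dJ_nonpos_arg(1)[OF nu that] .
  have eq: "ent_W \<nu> y / (ent_dJ \<nu> y)\<^sup>2 = (\<Sum>A\<in>Z. pole_weight \<nu> A / (A - y)\<^sup>2)" if "y \<le> 0" for y :: real
  proof -
    have "(\<lambda>i::nat. \<Sum>A\<in>Z. pole_weight \<nu> A / (A - y)\<^sup>2) \<longlonglongrightarrow> ent_W \<nu> y / (ent_dJ \<nu> y)\<^sup>2"
      by (rule partial_fractions_limit[OF nu, where R = real])
        (use fin P0[OF that] filterlim_real_sequentially in \<open>auto simp: Z_def incseq_def\<close>)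
    thus ?thesis by (simp add: LIMSEQ_const_iff)
  qed
  define u where "u = (\<lambda>t. \<Sum>A\<in>Z. pole_weight \<nu> A / (A + t))"
  define l where "l = ent_J \<nu> 0 / ent_dJ \<nu> 0 - u 0"
  have Meq: "ent_J \<nu> (-t) / ent_dJ \<nu> (-t) = l + u t" if "t \<ge> 0" for t
  proof -
    have "((\<lambda>t. ent_J \<nu> (-t) / ent_dJ \<nu> (-t) - u t) has_field_derivative 0) (at s within {0..})" if "s \<ge> 0" for s
    proof -
      have "((\<lambda>t. ent_J \<nu> (-t) / ent_dJ \<nu> (-t)) has_field_derivative ent_W \<nu> (-s) / (ent_dJ \<nu> (-s))\<^sup>2 * (-1)) (at s)"
        by (rule DERIV_chain2[OF ent_ratio_deriv[OF nu]]) (use P0[of "-s"] that in \<open>auto intro!: derivative_eq_intros\<close>)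
      moreover have "(u has_field_derivative (\<Sum>A\<in>Z. - (pole_weight \<nu> A / (A + s)\<^sup>2))) (at s)"
        unfolding u_def
      proof (rule DERIV_sum)
        fix A assume "A \<in> Z"
        hence "A + s \<noteq> 0" using Zpos[of A] that by linarith
        thus "((\<lambda>t. pole_weight \<nu> A / (A + t)) has_field_derivative - (pole_weight \<nu> A / (A + s)\<^sup>2)) (at s)"
          by (auto intro!: derivative_eq_intros simp: power2_eq_square)
      qed
      ultimately have "((\<lambda>t. ent_J \<nu> (-t) / ent_dJ \<nu> (-t) - u t) has_field_derivative
          ent_W \<nu> (-s) / (ent_dJ \<nu> (-s))\<^sup>2 * (-1) - (\<Sum>A\<in>Z. - (pole_weight \<nu> A / (A + s)\<^sup>2))) (at s)"
        by (rule DERIV_diff)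
      thus ?thesis using eq[of "-s"] that
        by (simp add: sum_negf has_field_derivative_at_within)
    qed
    hence "\<exists>c. \<forall>t\<in>{0..}. ent_J \<nu> (-t) / ent_dJ \<nu> (-t) - u t = c"
      by (intro has_field_derivative_zero_constant) auto
    then obtain c where c: "\<And>t. t \<ge> 0 \<Longrightarrow> ent_J \<nu> (-t) / ent_dJ \<nu> (-t) - u t = c" by auto
    thus ?thesis using c[of 0] c[OF that] by (simp add: l_def)
  qed
  \<comment> \<open>The Riccati equation at \<open>-t\<close>, with the finite expansions inserted.\<close>
  have ric: "- 2 * t * (\<Sum>A\<in>Z. pole_weight \<nu> A / (A + t)\<^sup>2) = 1 - (t + \<nu>\<^sup>2) * (l + u t)\<^sup>2" if "t \<ge> 0" for t
  proof -
    have "ent_dJ \<nu> (-t) > 0" using P0[of "-t"] that by simp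
    moreover have "2 * (-t) * ent_W \<nu> (-t) = (ent_dJ \<nu> (-t))\<^sup>2 + (-t - \<nu>\<^sup>2) * (ent_J \<nu> (-t))\<^sup>2"
      using ent_W_riccati[of "-t" \<nu>] by simp
    ultimately have "- 2 * t * (ent_W \<nu> (-t) / (ent_dJ \<nu> (-t))\<^sup>2) = 1 - (t + \<nu>\<^sup>2) * (ent_J \<nu> (-t) / ent_dJ \<nu> (-t))\<^sup>2"
      by (simp add: field_simps)
    thus ?thesis using eq[of "-t"] Meq[OF that] that by simp
  qed
  have u0: "(u \<longlongrightarrow> (\<Sum>A\<in>Z. 0)) at_top"
    unfolding u_def by (intro tendsto_sum) real_asymp
  have "((\<lambda>t. \<Sum>A\<in>Z. - 2 * t * (pole_weight \<nu> A / (A + t)\<^sup>2)) \<longlongrightarrow> (\<Sum>A\<in>Z. 0)) at_top"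
    by (intro tendsto_sum) real_asymp
  hence "((\<lambda>t. 1 - (- 2 * t * (\<Sum>A\<in>Z. pole_weight \<nu> A / (A + t)\<^sup>2))) \<longlongrightarrow> 1 - 0) at_top"
    by (intro tendsto_diff tendsto_const) (simp add: sum_distrib_left)
  moreover have "eventually (\<lambda>t. 1 - (- 2 * t * (\<Sum>A\<in>Z. pole_weight \<nu> A / (A + t)\<^sup>2)) = (t + \<nu>\<^sup>2) * (l + u t)\<^sup>2) at_top"
    using eventually_ge_at_top[of 0] by eventually_elim (use ric in simp)
  ultimately have lim1: "((\<lambda>t. (t + \<nu>\<^sup>2) * (l + u t)\<^sup>2) \<longlongrightarrow> 1) at_top"
    by (simp add: tendsto_cong)
  have "((\<lambda>t. 1 / (t + \<nu>\<^sup>2)) \<longlongrightarrow> 0) at_top" by real_asymp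
  from tendsto_mult[OF this lim1]
  have "((\<lambda>t. 1 / (t + \<nu>\<^sup>2) * ((t + \<nu>\<^sup>2) * (l + u t)\<^sup>2)) \<longlongrightarrow> 0) at_top" by simp
  moreover have "eventually (\<lambda>t. 1 / (t + \<nu>\<^sup>2) * ((t + \<nu>\<^sup>2) * (l + u t)\<^sup>2) = (l + u t)\<^sup>2) at_top"
    using eventually_gt_at_top[of 0]
  proof eventually_elim
    case (elim t)
    hence "t + \<nu>\<^sup>2 > 0" by (simp add: add_pos_nonneg)
    thus ?case by simp
  qed
  ultimately have "((\<lambda>t. (l + u t)\<^sup>2) \<longlongrightarrow> 0) at_top" by (simp add: tendsto_cong)
  moreover have "((\<lambda>t. (l + u t)\<^sup>2) \<longlongrightarrow> (l + 0)\<^sup>2) at_top"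
    using u0 by (intro tendsto_intros) auto
  ultimately have "(l + 0)\<^sup>2 = 0"
    by (intro tendsto_unique[of at_top "\<lambda>t. (l + u t)\<^sup>2"]) (simp_all only: trivial_limit_at_top_linorder not_False_eq_True)
  hence "l = 0" by simp
  have "((\<lambda>t. \<Sum>A\<in>Z. (t + \<nu>\<^sup>2) * (pole_weight \<nu> A / (A + t))) \<longlongrightarrow> (\<Sum>A\<in>Z. pole_weight \<nu> A)) at_top"
    by (intro tendsto_sum) real_asymp
  hence "((\<lambda>t. ((t + \<nu>\<^sup>2) * u t) * u t) \<longlongrightarrow> (\<Sum>A\<in>Z. pole_weight \<nu> A) * (\<Sum>A\<in>Z. 0)) at_top"
    using u0 by (intro tendsto_mult) (auto simp: u_def sum_distrib_left)
  hence "((\<lambda>t. (t + \<nu>\<^sup>2) * (l + u t)\<^sup>2) \<longlongrightarrow> 0) at_top"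
    using \<open>l = 0\<close> by (simp add: power2_eq_square mult.assoc)
  with lim1 have "(1::real) = 0" by (intro tendsto_unique) auto
  thus False by simp
qed

section \<open>Distribution of the zeros\<close>

lemma finite_real_zeros:
  fixes f :: "complex \<Rightarrow> complex"
  assumes "f holomorphic_on UNIV" "f 0 \<noteq> 0"
  shows "finite {x::real. \<bar>x\<bar> \<le> r \<and> f (of_real x) = 0}"
proof (cases "f constant_on UNIV")
  case True
  hence "f (of_real x) \<noteq> 0" for x using assms(2) by (metis UNIV_I constant_on_def)
  thus ?thesis by simp
next
  case False
  hence "finite {z\<in>cball 0 r. f z = 0}"
    by (intro holomorphic_compact_finite_zeros[OF assms(1)]) auto
  moreover have "of_real ` {x::real. \<bar>x\<bar> \<le> r \<and> f (of_real x) = 0} \<subseteq> {z\<in>cball 0 r. f z = 0}"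
    by auto
  ultimately have "finite (of_real ` {x::real. \<bar>x\<bar> \<le> r \<and> f (of_real x) = 0} :: complex set)"
    by (rule rev_finite_subset)
  thus ?thesis by (rule finite_imageD) (auto simp: inj_on_def)
qed

lemma finite_ent_J_zeros:
  assumes "\<nu> > 0" shows "finite {x::real. \<bar>x\<bar> \<le> r \<and> ent_J \<nu> x = 0}"
proof -
  have "ent_J \<nu> holomorphic_on (UNIV :: complex set)"
    unfolding holomorphic_on_def field_differentiable_def using ent_J_deriv[OF assms] by auto
  from finite_real_zeros[OF this ent_J_0_nonzero[OF assms]] show ?thesis
    using assms by (simp add: ent_J_of_real)
qed

lemma finite_ent_dJ_zeros:
  assumes "\<nu> > 0" shows "finite {x::real. \<bar>x\<bar> \<le> r \<and> ent_dJ \<nu> x = 0}"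
proof -
  have "ent_dJ \<nu> holomorphic_on (UNIV :: complex set)"
    unfolding holomorphic_on_def field_differentiable_def using ent_dJ_deriv[OF assms] by auto
  moreover have "ent_dJ \<nu> (0 :: complex) \<noteq> 0" using ent_J_0_nonzero[OF assms] assms by (simp add: ent_dJ_def)
  ultimately show ?thesis using finite_real_zeros[of "ent_dJ \<nu>" r] assms by (simp add: ent_dJ_of_real)
qed

lemma unbounded_ent_dJ_zeros:
  assumes "\<nu> > 0" shows "\<exists>A>X. ent_dJ \<nu> (A::real) = 0"
proof (rule ccontr)
  assume neg: "\<not> (\<exists>A>X. ent_dJ \<nu> A = 0)"
  have "{A::real. ent_dJ \<nu> A = 0} \<subseteq> {A. \<bar>A\<bar> \<le> X \<and> ent_dJ \<nu> A = 0}"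
  proof safe
    fix A :: real assume A: "ent_dJ \<nu> A = 0"
    hence "A > 0" using le_less_trans[OF zero_le_power2 ent_dJ_zero(1)[OF assms]] by blast
    thus "\<bar>A\<bar> \<le> X" using A neg by force
  qed
  thus False using infinite_ent_dJ_zeros[OF assms] finite_ent_dJ_zeros[OF assms, of X] finite_subset by blast
qed

text \<open>
  Rolle's theorem for \<open>x powr (\<nu>/2) * P(x)\<close>: Bessel's equation makes its derivative a multiple of
  \<open>(\<nu>\<^sup>2 - x) h(x)\<close>, and all zeros of \<open>P\<close> lie beyond \<open>\<nu>\<^sup>2\<close>.  In terms of \<open>J\<^sub>\<nu>\<close>, the function is
  \<open>x J\<^sub>\<nu>'(x)\<close> up to the substitution of \<open>x\<^sup>2\<close>.
\<close>
lemma unbounded_ent_J_zeros: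
  assumes "\<nu> > 0" shows "\<exists>y>X. ent_J \<nu> (y::real) = 0"
proof -
  obtain A where A: "A > X" "ent_dJ \<nu> A = 0" using unbounded_ent_dJ_zeros[OF assms] by blast
  obtain B where B: "B > A" "ent_dJ \<nu> B = 0" using unbounded_ent_dJ_zeros[OF assms] by blast
  have A0: "A > \<nu>\<^sup>2" using ent_dJ_zero(1)[OF assms A(2)] .
  have Apos: "A > 0" using le_less_trans[OF zero_le_power2 A0] .
  define F where "F = (\<lambda>x. ent_dJ \<nu> x * x powr (\<nu> / 2))"
  have dF: "(F has_real_derivative (\<nu>\<^sup>2 - x) * ent_J \<nu> x / 2 * x powr (\<nu> / 2 - 1)) (at x)" if x: "x > 0" for x
  proof -
    have "(F has_real_derivative (\<nu> * ent_J (\<nu> + 1) x / 4 - ent_J \<nu> x / 2) * x powr (\<nu> / 2)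
        + (\<nu> / 2 * x powr (\<nu> / 2 - 1)) * ent_dJ \<nu> x) (at x)"
      unfolding F_def using ent_dJ_deriv[OF assms, of x] x
      by (intro DERIV_mult) (auto intro!: derivative_eq_intros)
    moreover have "x powr (\<nu> / 2) = x * x powr (\<nu> / 2 - 1)"
      using x by (simp add: powr_diff)
    moreover have "(\<nu> * ent_J (\<nu> + 1) x / 4 - ent_J \<nu> x / 2) * (x * x powr (\<nu> / 2 - 1))
        + (\<nu> / 2 * x powr (\<nu> / 2 - 1)) * ent_dJ \<nu> x = (\<nu>\<^sup>2 - x) * ent_J \<nu> x / 2 * x powr (\<nu> / 2 - 1)"
      by (simp add: ent_dJ_def algebra_simps power2_eq_square add_divide_distrib diff_divide_distrib)
    ultimately show ?thesis by (simp only:)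
  qed
  have "\<exists>z>A. z < B \<and> (\<lambda>h. (\<nu>\<^sup>2 - z) * ent_J \<nu> z / 2 * z powr (\<nu> / 2 - 1) * h) = (\<lambda>h. 0)"
  proof (rule Rolle_deriv[OF B(1)])
    show "F A = F B" using A B by (simp add: F_def)
    show "continuous_on {A..B} F"
      by (rule DERIV_continuous_on[OF has_field_derivative_at_within[OF dF]]) (use Apos in auto)
    fix x assume "A < x" "x < B"
    thus "(F has_derivative (\<lambda>h. (\<nu>\<^sup>2 - x) * ent_J \<nu> x / 2 * x powr (\<nu> / 2 - 1) * h)) (at x)"
      using dF[of x, unfolded has_field_derivative_def] Apos by linarith
  qed
  then obtain z where z: "z > A" "(\<lambda>h. (\<nu>\<^sup>2 - z) * ent_J \<nu> z / 2 * z powr (\<nu> / 2 - 1) * h) = (\<lambda>h. 0)"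
    by blast
  have "(\<nu>\<^sup>2 - z) * ent_J \<nu> z / 2 * z powr (\<nu> / 2 - 1) = 0" using fun_cong[OF z(2), of 1] by simp
  hence "ent_J \<nu> z = 0" using A0 Apos z(1) by auto
  thus ?thesis using \<open>z > A\<close> A(1) by (intro exI[of _ z]) auto
qed

text \<open>
  Rolle's theorem for \<open>h\<close>, whose derivative is \<open>- ent_J (\<nu> + 1) / 4\<close>.
\<close>
lemma unbounded_ent_J_Suc_zeros:
  assumes "\<nu> > 0" shows "\<exists>y>X. ent_J (\<nu> + 1) (y::real) = 0"
proof -
  obtain A where A: "A > X" "ent_J \<nu> A = 0" using unbounded_ent_J_zeros[OF assms] by blast
  obtain B where B: "B > A" "ent_J \<nu> B = 0" using unbounded_ent_J_zeros[OF assms] by blast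
  obtain z where "z > A" "- ent_J (\<nu> + 1) z / 4 = 0"
    using Rolle[OF B(1), of "ent_J \<nu>"] A B ent_J_deriv[OF assms] 
    by (metis (mono_tags, lifting) DERIV_continuous_on DERIV_unique has_field_derivative_at_within real_differentiable_def)
  thus ?thesis using A(1) by (intro exI[of _ z]) auto
qed

text \<open>
  Local finiteness and unboundedness of the zero set ensure that the \<open>LEAST\<close> operator in each step of
  \<open>pos_zero\<close> selects an actual minimum.
\<close>
lemma pos_zero_enumeration:
  fixes f :: "real \<Rightarrow> real"
  assumes fin: "\<And>r. finite {x. 0 < x \<and> x \<le> r \<and> f x = 0}"
    and unb: "\<And>X. \<exists>x>X. f x = 0"
  shows "pos_zero f (Suc k) > 0" "f (pos_zero f (Suc k)) = 0"
    and "pos_zero f k < pos_zero f (Suc k)"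
    and "\<And>x. pos_zero f k < x \<Longrightarrow> x < pos_zero f (Suc k) \<Longrightarrow> f x \<noteq> 0"
proof -
  have least: "p < (LEAST x. p < x \<and> f x = 0) \<and> f (LEAST x. p < x \<and> f x = 0) = 0 \<and>
      (\<forall>x. p < x \<longrightarrow> x < (LEAST x. p < x \<and> f x = 0) \<longrightarrow> f x \<noteq> 0)" if p: "p \<ge> 0" for p
  proof -
    obtain y where y: "y > p" "f y = 0" using unb by blast
    define S where "S = {x. p < x \<and> x \<le> y \<and> f x = 0}"
    have "finite S" by (rule finite_subset[OF _ fin[of y]]) (use p in \<open>auto simp: S_def\<close>)
    moreover have "S \<noteq> {}" using y by (auto simp: S_def)
    ultimately have m: "Min S \<in> S" "\<And>x. x \<in> S \<Longrightarrow> Min S \<le> x" by auto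
    have le: "Min S \<le> x" if "p < x" "f x = 0" for x
      using m that by (cases "x \<le> y") (auto simp: S_def)
    have "(LEAST x. p < x \<and> f x = 0) = Min S"
      by (rule Least_equality) (use m(1) le in \<open>auto simp: S_def\<close>)
    thus ?thesis using m(1) le by (auto simp: S_def not_less[symmetric])
  qed
  have nn: "pos_zero f k \<ge> 0" for k
  proof (induction k)
    case (Suc k) thus ?case using least[OF Suc] by simp
  qed simp
  note l = least[OF nn[of k]]
  show "pos_zero f k < pos_zero f (Suc k)" "f (pos_zero f (Suc k)) = 0"
    "\<And>x. pos_zero f k < x \<Longrightarrow> x < pos_zero f (Suc k) \<Longrightarrow> f x \<noteq> 0"
    using l by simp_all
  thus "pos_zero f (Suc k) > 0" using nn[of k] by linarith
qed

lemma pos_zero_unbounded: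
  fixes f :: "real \<Rightarrow> real"
  assumes fin: "\<And>r. finite {x. 0 < x \<and> x \<le> r \<and> f x = 0}"
    and unb: "\<And>X. \<exists>x>X. f x = 0"
  shows "strict_mono (pos_zero f)" "filterlim (pos_zero f) at_top sequentially"
    and "\<And>x. x > 0 \<Longrightarrow> f x = 0 \<Longrightarrow> \<exists>k. x = pos_zero f (Suc k)"
proof -
  note e = pos_zero_enumeration[OF fin unb]
  show sm: "strict_mono (pos_zero f)" using e(3) by (simp add: strict_mono_Suc_iff)
  have ex: "\<exists>k. pos_zero f k > X" for X
  proof (rule ccontr)
    assume "\<nexists>k. pos_zero f k > X"
    hence "range (\<lambda>k. pos_zero f (Suc k)) \<subseteq> {x. 0 < x \<and> x \<le> X \<and> f x = 0}"
      using e(1,2) by (auto simp: not_less simp del: pos_zero.simps)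
    hence "finite (range (\<lambda>k. pos_zero f (Suc k)))" using fin finite_subset by blast
    moreover have "inj (\<lambda>k. pos_zero f (Suc k))"
      using strict_mono_imp_inj_on[OF sm] by (auto simp: inj_on_def simp del: pos_zero.simps)
    ultimately show False using finite_imageD by blast
  qed
  show "filterlim (pos_zero f) at_top sequentially"
    unfolding filterlim_at_top_dense eventually_sequentially
  proof
    fix X obtain k where "pos_zero f k > X" using ex by blast
    moreover have "pos_zero f n \<ge> pos_zero f k" if "n \<ge> k" for n
      using sm that by (simp add: strict_mono_less_eq)
    ultimately show "\<exists>N. \<forall>n\<ge>N. X < pos_zero f n" by (meson less_le_trans)
  qed
  fix x assume x: "x > 0" "f x = 0"
  define k where "k = (LEAST k. x \<le> pos_zero f k)"
  have "\<exists>k. x \<le> pos_zero f k" using ex[of x] less_imp_le by blast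
  hence k: "x \<le> pos_zero f k" "\<And>j. j < k \<Longrightarrow> pos_zero f j < x"
    unfolding k_def by (auto intro: LeastI_ex dest: not_less_Least)
  have "k \<noteq> 0" using k(1) x(1) by (cases k) auto
  then obtain j where j: "k = Suc j" by (cases k) auto
  have "pos_zero f j < x" using k(2) j by simp
  hence "\<not> x < pos_zero f (Suc j)" using e(4)[of j x] x(2) by blast
  hence "x = pos_zero f (Suc j)" using k(1) j by simp
  thus "\<exists>k. x = pos_zero f (Suc k)" by blast
qed

section \<open>Back to Bessel functions\<close>

lemma bessel_J_eq:
  assumes "\<nu> > 0" "x > 0"
  shows "bessel_J \<nu> x = (x / 2) powr \<nu> * ent_J \<nu> (x\<^sup>2)"
proof -
  have "(\<lambda>m. (x / 2) powr \<nu> * (bessel_coeff \<nu> m * (x\<^sup>2) ^ m)) sums ((x / 2) powr \<nu> * ent_J \<nu> (x\<^sup>2))"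
    using ent_J_sums[OF assms(1), of "x\<^sup>2"] by (intro sums_mult) simp
  also have "(\<lambda>m. (x / 2) powr \<nu> * (bessel_coeff \<nu> m * (x\<^sup>2) ^ m)) =
      (\<lambda>m. (-1) ^ m / (fact m * Gamma (real m + \<nu> + 1)) * (x / 2) powr (2 * real m + \<nu>))"
  proof
    fix m
    have "(x / 2) powr (2 * real m) = (x / 2) ^ (2 * m)"
      using powr_realpow[of "x / 2" "2 * m"] assms(2) by simp
    also have "\<dots> = (x\<^sup>2 / 4) ^ m"
      by (simp add: power_mult power_divide)
    finally have "(x / 2) powr (2 * real m + \<nu>) = (x\<^sup>2 / 4) ^ m * (x / 2) powr \<nu>"
      using assms(2) by (simp add: powr_add)
    moreover have "(-1/4) ^ m * (x\<^sup>2) ^ m = (-1) ^ m * (x\<^sup>2 / 4) ^ m"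
      by (simp flip: power_mult_distrib)
    ultimately show "(x / 2) powr \<nu> * (bessel_coeff \<nu> m * (x\<^sup>2) ^ m) =
      (-1) ^ m / (fact m * Gamma (real m + \<nu> + 1)) * (x / 2) powr (2 * real m + \<nu>)"
      by (simp add: bessel_coeff_def mult_ac)
  qed
  finally show ?thesis by (simp add: bessel_J_def sums_iff)
qed

lemma deriv_bessel_J_eq:
  assumes "\<nu> > 0" "x > 0"
  shows "deriv (bessel_J \<nu>) x = (x / 2) powr \<nu> / x * ent_dJ \<nu> (x\<^sup>2)"
proof -
  have "((\<lambda>x. (x / 2) powr \<nu> * ent_J \<nu> (x\<^sup>2)) has_real_derivative
      (\<nu> * (x / 2) powr (\<nu> - 1) * (1 / 2)) * ent_J \<nu> (x\<^sup>2) +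
      (- ent_J (\<nu> + 1) (x\<^sup>2) / 4 * (2 * x)) * (x / 2) powr \<nu>) (at x)"
  proof (rule DERIV_mult)
    show "((\<lambda>x. (x / 2) powr \<nu>) has_real_derivative \<nu> * (x / 2) powr (\<nu> - 1) * (1 / 2)) (at x)"
      using assms(2) by (auto intro!: derivative_eq_intros)
    show "((\<lambda>x. ent_J \<nu> (x\<^sup>2)) has_real_derivative - ent_J (\<nu> + 1) (x\<^sup>2) / 4 * (2 * x)) (at x)"
      by (rule ent_J_chain[OF assms(1)]) (auto intro!: derivative_eq_intros)
  qed
  moreover have "(x / 2) powr (\<nu> - 1) = (x / 2) powr \<nu> * 2 / x"
    using assms(2) by (simp add: powr_diff)
  moreover have "(\<nu> * ((x / 2) powr \<nu> * 2 / x) * (1 / 2)) * ent_J \<nu> (x\<^sup>2) +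
      (- ent_J (\<nu> + 1) (x\<^sup>2) / 4 * (2 * x)) * (x / 2) powr \<nu> = (x / 2) powr \<nu> / x * ent_dJ \<nu> (x\<^sup>2)"
    using assms(2) by (simp add: ent_dJ_def power2_eq_square right_diff_distrib mult_ac)
  ultimately have "((\<lambda>x. (x / 2) powr \<nu> * ent_J \<nu> (x\<^sup>2)) has_real_derivative
      (x / 2) powr \<nu> / x * ent_dJ \<nu> (x\<^sup>2)) (at x)" by (simp only:)
  hence "(bessel_J \<nu> has_real_derivative (x / 2) powr \<nu> / x * ent_dJ \<nu> (x\<^sup>2)) (at x)"
    by (rule has_field_derivative_transform_within_open[where S = "{0<..}"])
      (use assms bessel_J_eq in auto)
  thus ?thesis by (rule DERIV_imp_deriv)
qed

lemma square_zeros_locally_finite: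
  fixes f g :: "real \<Rightarrow> real"
  assumes fin: "\<And>r. finite {x. \<bar>x\<bar> \<le> r \<and> g x = 0}"
    and f: "\<And>x. x > 0 \<Longrightarrow> f x = 0 \<longleftrightarrow> g (x\<^sup>2) = 0"
  shows "finite {x. 0 < x \<and> x \<le> r \<and> f x = 0}"
proof (rule finite_imageD[where f = "\<lambda>x. x\<^sup>2"])
  show "finite ((\<lambda>x. x\<^sup>2) ` {x. 0 < x \<and> x \<le> r \<and> f x = 0})"
    by (rule finite_subset[OF _ fin[of "r\<^sup>2"]]) (use f in \<open>auto intro: power_mono\<close>)
  show "inj_on (\<lambda>x. x\<^sup>2) {x. 0 < x \<and> x \<le> r \<and> f x = 0}"
    by (auto simp: inj_on_def power2_eq_iff)
qed

lemma square_zeros_unbounded: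
  fixes f g :: "real \<Rightarrow> real"
  assumes unb: "\<And>X. \<exists>y>X. g y = 0"
    and f: "\<And>x. x > 0 \<Longrightarrow> f x = 0 \<longleftrightarrow> g (x\<^sup>2) = 0"
  shows "\<exists>x>X. f x = 0"
proof -
  obtain y where y: "y > X\<^sup>2" "g y = 0" using unb by blast
  have "y > 0" using le_less_trans[OF zero_le_power2 y(1)] .
  moreover have "sqrt y > X" using y(1) real_less_rsqrt by blast
  ultimately show ?thesis using f[of "sqrt y"] y(2) by (intro exI[of _ "sqrt y"]) auto
qed

theorem mainTheorem12:
  fixes \<nu> :: real and n :: nat
  assumes "\<nu> > 0" and "n \<ge> 1"
  shows "(\<lambda>k. (bessel_deriv_zero \<nu> (Suc k))\<^sup>2 /
              (((bessel_deriv_zero \<nu> (Suc k))\<^sup>2 - \<nu>\<^sup>2) *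
               ((bessel_zero (\<nu> + 1) n)\<^sup>2 - (bessel_deriv_zero \<nu> (Suc k))\<^sup>2)\<^sup>2))
         sums (1 / (4 * \<nu>\<^sup>2))"
proof -
  define a where "a = (\<lambda>k. bessel_deriv_zero \<nu> (Suc k))"
  define b where "b = bessel_zero (\<nu> + 1) n"
  have f1: "deriv (bessel_J \<nu>) x = 0 \<longleftrightarrow> ent_dJ \<nu> (x\<^sup>2) = 0" if "x > 0" for x
    using that deriv_bessel_J_eq[OF assms(1) that] by simp
  have f2: "bessel_J (\<nu> + 1) x = 0 \<longleftrightarrow> ent_J (\<nu> + 1) (x\<^sup>2) = 0" if "x > 0" for x
    using that bessel_J_eq[of "\<nu> + 1" x] assms(1) by simp
  have fin1: "finite {x. 0 < x \<and> x \<le> r \<and> deriv (bessel_J \<nu>) x = 0}" for r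
    by (rule square_zeros_locally_finite[OF finite_ent_dJ_zeros[OF assms(1)] f1])
  have unb1: "\<exists>x>X. deriv (bessel_J \<nu>) x = 0" for X
    by (rule square_zeros_unbounded[OF unbounded_ent_dJ_zeros[OF assms(1)] f1])
  have fin2: "finite {x. 0 < x \<and> x \<le> r \<and> bessel_J (\<nu> + 1) x = 0}" for r
    by (rule square_zeros_locally_finite[OF finite_ent_J_zeros f2]) (use assms(1) in auto)
  have unb2: "\<exists>x>X. bessel_J (\<nu> + 1) x = 0" for X
    by (rule square_zeros_unbounded[OF unbounded_ent_J_Suc_zeros[OF assms(1)] f2])
  have b: "b > 0" "ent_J (\<nu> + 1) (b\<^sup>2) = 0"
  proof -
    obtain m where n: "n = Suc m" using assms(2) by (cases n) auto
    show "b > 0" using pos_zero_enumeration(1)[OF fin2 unb2, of m] by (simp add: b_def bessel_zero_def n)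
    thus "ent_J (\<nu> + 1) (b\<^sup>2) = 0" using pos_zero_enumeration(2)[OF fin2 unb2, of m] f2[of b]
      by (simp add: b_def bessel_zero_def n)
  qed
  note pz = pos_zero_unbounded[OF fin1 unb1]
  have a: "a k > 0" "ent_dJ \<nu> ((a k)\<^sup>2) = 0" for k
  proof -
    show "a k > 0" using pos_zero_enumeration(1)[OF fin1 unb1, of k]
      by (simp add: a_def bessel_deriv_zero_def)
    thus "ent_dJ \<nu> ((a k)\<^sup>2) = 0" using pos_zero_enumeration(2)[OF fin1 unb1, of k] f1[of "a k"]
      by (simp add: a_def bessel_deriv_zero_def)
  qed
  have sm: "strict_mono a"
    using pz(1) by (simp add: strict_mono_def a_def bessel_deriv_zero_def del: pos_zero.simps)
  have aeq: "a = (\<lambda>k. pos_zero (deriv (bessel_J \<nu>)) (Suc k))"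
    by (simp add: a_def bessel_deriv_zero_def fun_eq_iff)
  have alim: "filterlim a at_top sequentially"
    unfolding aeq by (rule filterlim_compose[OF pz(2) filterlim_Suc])
  have ex: "\<exists>k. x = a k" if "x > 0" "ent_dJ \<nu> (x\<^sup>2) = 0" for x
    using pz(3)[OF that(1)] f1[OF that(1)] that(2) unfolding aeq by blast
  define T where "T = (\<lambda>i::nat. (\<lambda>k. (a k)\<^sup>2) ` {..<i})"
  have inj: "inj (\<lambda>k. (a k)\<^sup>2)"
  proof (rule injI)
    fix i j assume "(a i)\<^sup>2 = (a j)\<^sup>2"
    hence "a i = a j" using a(1)[of i] a(1)[of j] by (simp add: power2_eq_iff)
    thus "i = j" by (simp add: strict_mono_eq[OF sm])
  qed
  \<comment> \<open>\<open>h\<close> and \<open>h'\<close> have no common zero, because it would be a zero of \<open>P\<close> with \<open>h = 0\<close>.\<close>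
  have hb: "ent_J \<nu> (b\<^sup>2) \<noteq> 0"
  proof
    assume h: "ent_J \<nu> (b\<^sup>2) = 0"
    hence "ent_dJ \<nu> (b\<^sup>2) = 0" using b(2) by (simp add: ent_dJ_def)
    thus False using ent_dJ_zero(2)[OF assms(1)] h by blast
  qed
  have Pb: "ent_dJ \<nu> (b\<^sup>2) = \<nu> * ent_J \<nu> (b\<^sup>2)" using b(2) by (simp add: ent_dJ_def)
  have "(\<lambda>i. \<Sum>A\<in>T i. pole_weight \<nu> A / (A - b\<^sup>2)\<^sup>2) \<longlonglongrightarrow> ent_W \<nu> (b\<^sup>2) / (ent_dJ \<nu> (b\<^sup>2))\<^sup>2"
  \<comment> \<open>The disc of radius \<open>(a i)\<^sup>2\<close> contains precisely the first \<open>i\<close> poles.\<close>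
  proof (rule partial_fractions_limit[where R = "\<lambda>i. (a i)\<^sup>2"])
    show "filterlim (\<lambda>i. (a i)\<^sup>2) at_top sequentially"
      by (rule filterlim_pow_at_top[OF _ alim]) simp
    show "ent_dJ \<nu> (b\<^sup>2) \<noteq> 0" using Pb hb assms(1) by simp
    fix i A assume A: "ent_dJ \<nu> A = 0" "A < (a i)\<^sup>2"
    have "A > 0" using le_less_trans[OF zero_le_power2 ent_dJ_zero(1)[OF assms(1) A(1)]] .
    then obtain k where k: "sqrt A = a k" using ex[of "sqrt A"] A(1) by auto
    hence Ak: "A = (a k)\<^sup>2" using \<open>A > 0\<close> by (metis less_imp_le real_sqrt_pow2)
    hence "a k < a i" using A(2) a(1)[of i] by (simp add: power_less_imp_less_base less_imp_le)
    hence "k < i" using sm strict_mono_less by blast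
    thus "A \<in> T i" using Ak by (auto simp: T_def)
  qed (use assms(1) a(2) in \<open>auto simp: T_def incseq_def\<close>)
  also have "ent_W \<nu> (b\<^sup>2) / (ent_dJ \<nu> (b\<^sup>2))\<^sup>2 = 1 / (2 * \<nu>\<^sup>2)"
    unfolding Pb using hb assms(1) b(2) by (simp add: ent_W_def power_mult_distrib)
  also have "(\<lambda>i. \<Sum>A\<in>T i. pole_weight \<nu> A / (A - b\<^sup>2)\<^sup>2) = (\<lambda>i. \<Sum>k<i. pole_weight \<nu> ((a k)\<^sup>2) / ((a k)\<^sup>2 - b\<^sup>2)\<^sup>2)"
    unfolding T_def using inj by (subst sum.reindex) (auto intro: inj_on_subset simp: o_def)
  finally have "(\<lambda>k. pole_weight \<nu> ((a k)\<^sup>2) / ((a k)\<^sup>2 - b\<^sup>2)\<^sup>2) sums (1 / (2 * \<nu>\<^sup>2))"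
    by (simp add: sums_def)
  from sums_divide[OF this, of 2]
  have "(\<lambda>k. pole_weight \<nu> ((a k)\<^sup>2) / ((a k)\<^sup>2 - b\<^sup>2)\<^sup>2 / 2) sums (1 / (4 * \<nu>\<^sup>2))"
    by simp
  also have "(\<lambda>k. pole_weight \<nu> ((a k)\<^sup>2) / ((a k)\<^sup>2 - b\<^sup>2)\<^sup>2 / 2)
      = (\<lambda>k. (a k)\<^sup>2 / (((a k)\<^sup>2 - \<nu>\<^sup>2) * (b\<^sup>2 - (a k)\<^sup>2)\<^sup>2))"
  proof
    fix k
    show "pole_weight \<nu> ((a k)\<^sup>2) / ((a k)\<^sup>2 - b\<^sup>2)\<^sup>2 / 2 = (a k)\<^sup>2 / (((a k)\<^sup>2 - \<nu>\<^sup>2) * (b\<^sup>2 - (a k)\<^sup>2)\<^sup>2)"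
      unfolding power2_commute[of "(a k)\<^sup>2" "b\<^sup>2"] by (simp add: pole_weight_def)
  qed
  finally show ?thesis unfolding a_def b_def .
qed

end
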